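(* Assume (1), (2), (3) of the context, and let $\delta>0$ be the precision of the inner solver. Forward case: if $\nu=\nu(\delta)$ is chosen with $\nu\sim\delta^{1/2}$ (i.e. $c_1\delta^{1/2}\le\nu\le c_2\delta^{1/2}$ for fixed constants $0<c_1\le c_2$), then $$\|\nabla F_i(\theta)-\tilde g^{\mathrm{For}}_{i,\nu}(\theta)\|=\mathcal{O}(\lambda\,\delta^{1/2}).$$ Symmetric case: if moreover (1') and (2') of the context hold and $\nu=\nu(\delta)$ is chosen with $\nu\sim\delta^{1/3}$ (i.e. $c_1\delta^{1/3}\le\nu\le c_2\delta^{1/3}$), then $$\|\nabla F_i(\theta)-\tilde g^{\mathrm{Sym}}_{i,\nu}(\theta)\|=\mathcal{O}(\lambda\,\delta^{2/3}).$$ Here $\mathcal{O}$ refers to $\delta\to0^+$, uniformly in $i\in\{1,\dots,M\}$, in $\theta\in\mathbb{R}^d$ and in the choice of approximate solutions; the implied constants (and the threshold on $\delta$) depend only on $c_1,c_2,L_0,L_1,L_2,\hat L_1,\hat L_2,\hat L_3,\lambda,\mu$.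
   Context: There are $M$ training tasks. Task $i$ has a training objective $\hat f_i:\mathbb{R}^d\to\mathbb{R}$ and a test objective $f_i:\mathbb{R}^d\to\mathbb{R}$. Let $\lambda>0$ and let $\|\cdot\|$ be the Euclidean (resp. operator) norm. Definitions. For $\nu\in\mathbb{R}$ near $0$ and $\theta\in\mathbb{R}^d$ let $$\phi^\star_{i,\nu}(\theta)=\arg\min_{\phi\in\mathbb{R}^d}\ \nu f_i(\phi)+\hat f_i(\phi)+\frac{\lambda}{2}\|\phi-\theta\|^2 ,$$ which under (1)-(3) below is uniquely defined for $|\nu|<\mu/L_1$. Put $F_i(\theta)=f_i(\phi^\star_{i,0}(\theta))$. For each $\nu$ used, the inner solver returns an approximate solution $\tilde\phi_{i,\nu}(\theta)\in\mathbb{R}^d$ with $\|\tilde\phi_{i,\nu}(\theta)-\phi^\star_{i,\nu}(\theta)\|\le\delta$. The estimators built from approximate solutions are $$\tilde g^{\mathrm{For}}_{i,\nu}(\theta)=-\lambda\,\frac{\tilde\phi_{i,\nu}(\theta)-\tilde\phi_{i,0}(\theta)}{\nu},\qquad \tilde g^{\mathrm{Sym}}_{i,\nu}(\theta)=-\lambda\,\frac{\tilde\phi_{i,\nu}(\theta)-\tilde\phi_{i,-\nu}(\theta)}{2\nu}.$$ Assumptions, for every $i$: (1) $\hat f_i$ is twice differentiable, $\hat L_1$-smooth (its gradient is $\hat L_1$-Lipschitz) and has $\hat L_2$-Lipschitz Hessian. (1') $\hat f_i$ is $C^4$ with bounded fourth derivative, its third derivative being $\hat L_3$-Lipschitz.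 (2) $f_i$ is differentiable, $L_0$-Lipschitz and $L_1$-smooth (its gradient is $L_1$-Lipschitz). (2') $f_i$ is $C^3$ and its second derivative is $L_2$-Lipschitz. (3) $\mu>0$ and $\hat f_i+\frac{\lambda}{2}\|\cdot\|^2$ is $\mu$-strongly convex. *)

theory Defs
  imports "HOL-Analysis.Analysis"
begin

text \<open>
  The constants of the result must not depend on the dimension \<open>d\<close>, so \<open>d\<close> is a value and not a
  type here. All spaces \<open>\<real>\<^sup>d\<close> are realised inside one inner product space, the finitely supported
  real sequences: \<open>Rn d\<close> consists of the sequences supported on \<open>{..<d}\<close>, with the Euclidean
  inner product.
\<close>

typedef fseq = "{x :: nat \<Rightarrow> real. finite {i. x i \<noteq> 0}}"
  morphisms coord Fseq
  by (rule exI[of _ "\<lambda>_. 0"]) simp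

lemma finite_support [simp]: "finite {i. coord x i \<noteq> 0}"
  using coord[of x] by simp

lemma fseq_eqI: "(\<And>i. coord x i = coord y i) \<Longrightarrow> x = y"
  by (metis coord_inject ext)

instantiation fseq :: real_vector
begin

definition "0 = Fseq (\<lambda>_. 0)"
definition "x + y = Fseq (\<lambda>i. coord x i + coord y i)"
definition "x - y = Fseq (\<lambda>i. coord x i - coord y i)"
definition "- x = Fseq (\<lambda>i. - coord x i)"
definition "r *\<^sub>R x = Fseq (\<lambda>i. r * coord x i)"

lemma coord_zero [simp]: "coord 0 i = 0"
  unfolding zero_fseq_def by (subst Fseq_inverse) auto

lemma coord_add [simp]: "coord (x + y) i = coord x i + coord y i"
  unfolding plus_fseq_def
  by (subst Fseq_inverse)
     (auto intro: finite_subset[of _ "{i. coord x i \<noteq> 0} \<union> {i. coord y i \<noteq> 0}"])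

lemma coord_diff [simp]: "coord (x - y) i = coord x i - coord y i"
  unfolding minus_fseq_def
  by (subst Fseq_inverse)
     (auto intro: finite_subset[of _ "{i. coord x i \<noteq> 0} \<union> {i. coord y i \<noteq> 0}"])

lemma coord_uminus [simp]: "coord (- x) i = - coord x i"
  unfolding uminus_fseq_def by (subst Fseq_inverse) auto

lemma coord_scaleR [simp]: "coord (r *\<^sub>R x) i = r * coord x i"
  unfolding scaleR_fseq_def
  by (subst Fseq_inverse) (auto intro: finite_subset[of _ "{i. coord x i \<noteq> 0}"])

instance
  by standard (auto intro!: fseq_eqI simp: algebra_simps)

end

instantiation fseq :: real_inner
begin

definition "inner x y = (\<Sum>i | coord x i \<noteq> 0. coord x i * coord y i)"
definition "norm (x :: fseq) = sqrt (inner x x)"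
definition "dist (x :: fseq) y = norm (x - y)"
definition "sgn (x :: fseq) = x /\<^sub>R norm x"
definition [code del]:
  "(uniformity :: (fseq \<times> fseq) filter) = (INF e\<in>{0<..}. principal {(x, y). dist x y < e})"
definition [code del]:
  "open (U :: fseq set) = (\<forall>x\<in>U. eventually (\<lambda>(x', y). x' = x \<longrightarrow> y \<in> U) uniformity)"

lemma inner_fseq_superset:
  assumes "finite A" "{i. coord x i \<noteq> 0} \<subseteq> A"
  shows "inner x y = (\<Sum>i\<in>A. coord x i * coord y i)"
  unfolding inner_fseq_def by (rule sum.mono_neutral_left) (use assms in auto)

instance
proof
  fix x y z :: fseq and r :: real
  let ?A = "{i. coord x i \<noteq> 0} \<union> {i. coord y i \<noteq> 0}"
  have sub: "{i. coord (x + y) i \<noteq> 0} \<subseteq> ?A" by auto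
  show "inner x y = inner y x"
    by (subst (1 2) inner_fseq_superset[of ?A]) (auto simp: mult.commute)
  have "inner (x + y) z = (\<Sum>i\<in>?A. coord (x + y) i * coord z i)"
    by (rule inner_fseq_superset) (use sub in auto)
  also have "\<dots> = (\<Sum>i\<in>?A. coord x i * coord z i) + (\<Sum>i\<in>?A. coord y i * coord z i)"
    by (simp add: sum.distrib algebra_simps)
  also have "\<dots> = inner x z + inner y z"
    by (subst (1 2) inner_fseq_superset[of ?A]) auto
  finally show "inner (x + y) z = inner x z + inner y z" .
  have "inner (r *\<^sub>R x) y = (\<Sum>i | coord x i \<noteq> 0. coord (r *\<^sub>R x) i * coord y i)"
    by (rule inner_fseq_superset) auto
  then show "inner (r *\<^sub>R x) y = r * inner x y"
    by (simp add: inner_fseq_def sum_distrib_left mult.assoc)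
  show "0 \<le> inner x x"
    unfolding inner_fseq_def by (rule sum_nonneg) auto
  show "inner x x = 0 \<longleftrightarrow> x = 0"
    unfolding inner_fseq_def
    by (subst sum_nonneg_eq_0_iff) (auto intro: fseq_eqI)
qed (simp_all only: norm_fseq_def dist_fseq_def sgn_fseq_def uniformity_fseq_def open_fseq_def)

end

definition Rn :: "nat \<Rightarrow> fseq set" where
  "Rn d = {x. \<forall>i\<ge>d. coord x i = 0}"

definition trunc :: "nat \<Rightarrow> fseq \<Rightarrow> fseq" where
  "trunc d x = Fseq (\<lambda>i. if i < d then coord x i else 0)"

lemma coord_trunc: "coord (trunc d x) i = (if i < d then coord x i else 0)"
  unfolding trunc_def by (subst Fseq_inverse) auto

lemma subspace_Rn: "subspace (Rn d)"
  by (auto simp: subspace_def Rn_def)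

lemma inner_Rn:
  assumes "x \<in> Rn d"
  shows "inner x y = (\<Sum>i<d. coord x i * coord y i)"
  by (rule inner_fseq_superset) (use assms in \<open>auto simp: Rn_def not_le[symmetric]\<close>)

lemma norm_Rn: "x \<in> Rn d \<Longrightarrow> norm x = L2_set (coord x) {..<d}"
  by (simp add: norm_fseq_def inner_Rn L2_set_def power2_eq_square)

lemma coord_surj_Rn: "\<exists>x\<in>Rn d. \<forall>i<d. coord x i = v i"
proof
  have eq: "coord (Fseq (\<lambda>i. if i < d then v i else 0)) = (\<lambda>i. if i < d then v i else 0)"
    by (rule Fseq_inverse) auto
  show "Fseq (\<lambda>i. if i < d then v i else 0) \<in> Rn d"
    by (auto simp: Rn_def eq)
  show "\<forall>i<d. coord (Fseq (\<lambda>i. if i < d then v i else 0)) i = v i"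
    by (auto simp: eq)
qed

lemma trunc_Rn: "trunc d x \<in> Rn d"
  by (auto simp: Rn_def coord_trunc)

lemma trunc_id: "x \<in> Rn d \<Longrightarrow> trunc d x = x"
  by (auto simp: Rn_def coord_trunc not_less intro!: fseq_eqI)

lemma trunc_orthogonal: "y \<in> Rn d \<Longrightarrow> inner y (x - trunc d x) = 0"
  by (simp add: inner_Rn coord_trunc)

lemma norm_trunc_le: "norm (trunc d x) \<le> norm x"
proof -
  have "inner (trunc d x) (x - trunc d x) = 0"
    by (rule trunc_orthogonal[OF trunc_Rn])
  then have "(norm x)\<^sup>2 = (norm (trunc d x))\<^sup>2 + (norm (x - trunc d x))\<^sup>2"
    by (simp add: power2_norm_eq_inner inner_diff_left inner_diff_right inner_commute)
  then show ?thesis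
    by (metis le_add_same_cancel1 norm_ge_zero power2_le_imp_le zero_le_power2)
qed

lemma bounded_linear_trunc: "bounded_linear (trunc d)"
  by (rule bounded_linear_intro[of _ 1])
     (auto intro!: fseq_eqI simp: coord_trunc norm_trunc_le)

text \<open>
  A function \<open>\<real>\<^sup>d \<rightarrow> \<real>\<close> is represented by the function on the ambient space that reads only the first
  \<open>d\<close> coordinates (a bijective correspondence). Its Frechet derivatives in the ambient space are
  then unique, and they are those on \<open>\<real>\<^sup>d\<close> composed with the orthogonal projection \<open>trunc d\<close>; so
  gradients (which lie in \<open>Rn d\<close>) and operator norms are the ones on \<open>\<real>\<^sup>d\<close>.
\<close>

definition fun_on_Rn :: "nat \<Rightarrow> (fseq \<Rightarrow> 'b) \<Rightarrow> bool" where
  "fun_on_Rn d f \<longleftrightarrow> (\<forall>x. f (trunc d x) = f x)"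

lemma has_derivative_fun_on_Rn:
  fixes f :: "fseq \<Rightarrow> 'b::real_normed_vector"
  assumes f: "fun_on_Rn d f" and x: "x \<in> Rn d"
  shows "(f has_derivative f') (at x) \<longleftrightarrow>
    (f has_derivative f') (at x within Rn d) \<and> (\<forall>h. f' (trunc d h) = f' h)"
proof
  assume D: "(f has_derivative f') (at x)"
  have "(f \<circ> trunc d has_derivative f' \<circ> trunc d) (at x)"
    by (rule diff_chain_at) 
       (use D x in \<open>auto simp: trunc_id intro: bounded_linear_imp_has_derivative bounded_linear_trunc\<close>)
  moreover have "f \<circ> trunc d = f" using f by (auto simp: fun_on_Rn_def)
  ultimately have "f' \<circ> trunc d = f'" using D has_derivative_unique by metis
  then show "(f has_derivative f') (at x within Rn d) \<and> (\<forall>h. f' (trunc d h) = f' h)"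
    using D has_derivative_at_withinI by (metis comp_apply)
next
  assume D: "(f has_derivative f') (at x within Rn d) \<and> (\<forall>h. f' (trunc d h) = f' h)"
  have "(f \<circ> trunc d has_derivative f' \<circ> trunc d) (at x within UNIV)"
  proof (rule diff_chain_within)
    show "(trunc d has_derivative trunc d) (at x within UNIV)"
      by (rule bounded_linear_imp_has_derivative[OF bounded_linear_trunc])
    show "(f has_derivative f') (at (trunc d x) within range (trunc d))"
      using D x trunc_Rn by (auto simp: trunc_id intro: has_derivative_subset)
  qed
  moreover have "f \<circ> trunc d = f" "f' \<circ> trunc d = f'"
    using f D by (auto simp: fun_on_Rn_def)
  ultimately show "(f has_derivative f') (at x)" by simp
qed

definition gradient :: "('a::real_inner \<Rightarrow> real) \<Rightarrow> 'a \<Rightarrow> 'a" where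
  "gradient f x = (THE g. GDERIV f x :> g)"

definition fderiv :: "('a::real_normed_vector \<Rightarrow> 'b::real_normed_vector) \<Rightarrow> 'a \<Rightarrow> 'a \<Rightarrow>\<^sub>L 'b" where
  "fderiv f x = Blinfun (frechet_derivative f (at x))"

abbreviation D1 :: "(fseq \<Rightarrow> real) \<Rightarrow> fseq \<Rightarrow> fseq \<Rightarrow>\<^sub>L real" where
  "D1 f \<equiv> fderiv f"

abbreviation D2 :: "(fseq \<Rightarrow> real) \<Rightarrow> fseq \<Rightarrow> fseq \<Rightarrow>\<^sub>L fseq \<Rightarrow>\<^sub>L real" where
  "D2 f \<equiv> fderiv (D1 f)"

abbreviation D3 :: "(fseq \<Rightarrow> real) \<Rightarrow> fseq \<Rightarrow> fseq \<Rightarrow>\<^sub>L fseq \<Rightarrow>\<^sub>L fseq \<Rightarrow>\<^sub>L real" where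
  "D3 f \<equiv> fderiv (D2 f)"

abbreviation D4 :: "(fseq \<Rightarrow> real) \<Rightarrow> fseq \<Rightarrow> fseq \<Rightarrow>\<^sub>L fseq \<Rightarrow>\<^sub>L fseq \<Rightarrow>\<^sub>L fseq \<Rightarrow>\<^sub>L real" where
  "D4 f \<equiv> fderiv (D3 f)"

definition diff_on_Rn :: "nat \<Rightarrow> (fseq \<Rightarrow> 'b::real_normed_vector) \<Rightarrow> bool" where
  "diff_on_Rn d f \<longleftrightarrow> (\<forall>x\<in>Rn d. f differentiable (at x))"

definition strongly_convex_on :: "'a::real_normed_vector set \<Rightarrow> real \<Rightarrow> ('a \<Rightarrow> real) \<Rightarrow> bool" where
  "strongly_convex_on S \<mu> g \<longleftrightarrow> (\<forall>x\<in>S. \<forall>y\<in>S. \<forall>t\<in>{0..1}.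
     g ((1 - t) *\<^sub>R x + t *\<^sub>R y) \<le> (1 - t) * g x + t * g y - \<mu> / 2 * t * (1 - t) * (norm (x - y))\<^sup>2)"

definition L_smooth :: "nat \<Rightarrow> real \<Rightarrow> (fseq \<Rightarrow> real) \<Rightarrow> bool" where
  "L_smooth d L f \<longleftrightarrow> diff_on_Rn d f \<and> L-lipschitz_on (Rn d) (gradient f)"

text \<open>The Hessian is the second derivative as a bilinear form; its norm as an iterated bounded
  linear map is the operator norm of the Hessian matrix.\<close>

definition train_regular :: "nat \<Rightarrow> real \<Rightarrow> real \<Rightarrow> (fseq \<Rightarrow> real) \<Rightarrow> bool" where
  "train_regular d Lh1 Lh2 fh \<longleftrightarrow>
     diff_on_Rn d fh \<and> diff_on_Rn d (D1 fh) \<and>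
     L_smooth d Lh1 fh \<and> Lh2-lipschitz_on (Rn d) (D2 fh)"

definition train_C4 :: "nat \<Rightarrow> real \<Rightarrow> (fseq \<Rightarrow> real) \<Rightarrow> bool" where
  "train_C4 d Lh3 fh \<longleftrightarrow>
     diff_on_Rn d fh \<and> diff_on_Rn d (D1 fh) \<and> diff_on_Rn d (D2 fh) \<and> diff_on_Rn d (D3 fh) \<and>
     continuous_on (Rn d) (D4 fh) \<and> bounded (D4 fh ` Rn d) \<and>
     Lh3-lipschitz_on (Rn d) (D3 fh)"

definition test_regular :: "nat \<Rightarrow> real \<Rightarrow> real \<Rightarrow> (fseq \<Rightarrow> real) \<Rightarrow> bool" where
  "test_regular d L0 L1 f \<longleftrightarrow>
     diff_on_Rn d f \<and> L0-lipschitz_on (Rn d) f \<and> L_smooth d L1 f"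

definition test_C3 :: "nat \<Rightarrow> real \<Rightarrow> (fseq \<Rightarrow> real) \<Rightarrow> bool" where
  "test_C3 d L2 f \<longleftrightarrow>
     diff_on_Rn d f \<and> diff_on_Rn d (D1 f) \<and> diff_on_Rn d (D2 f) \<and>
     continuous_on (Rn d) (D3 f) \<and> L2-lipschitz_on (Rn d) (D2 f)"

definition train_strongly_convex :: "nat \<Rightarrow> real \<Rightarrow> real \<Rightarrow> (fseq \<Rightarrow> real) \<Rightarrow> bool" where
  "train_strongly_convex d lam \<mu> fh \<longleftrightarrow>
     strongly_convex_on (Rn d) \<mu> (\<lambda>\<phi>. fh \<phi> + lam / 2 * (norm \<phi>)\<^sup>2)"

definition inner_sol ::
    "nat \<Rightarrow> real \<Rightarrow> (fseq \<Rightarrow> real) \<Rightarrow> (fseq \<Rightarrow> real) \<Rightarrow> real \<Rightarrow> fseq \<Rightarrow> fseq" where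
  "inner_sol d lam f fh \<nu> \<theta> =
     arg_min_on (\<lambda>\<phi>. \<nu> * f \<phi> + fh \<phi> + lam / 2 * (norm (\<phi> - \<theta>))\<^sup>2) (Rn d)"

definition meta_obj ::
    "nat \<Rightarrow> real \<Rightarrow> (fseq \<Rightarrow> real) \<Rightarrow> (fseq \<Rightarrow> real) \<Rightarrow> fseq \<Rightarrow> real" where
  "meta_obj d lam f fh \<theta> = f (inner_sol d lam f fh 0 \<theta>)"

text \<open>So derivatives of the meta-objective in the ambient space are again those on \<open>\<real>\<^sup>d\<close>.\<close>

lemma fun_on_Rn_meta_obj: "fun_on_Rn d (meta_obj d lam f fh)"
proof -
  have "inner_sol d lam f fh 0 (trunc d \<theta>) = inner_sol d lam f fh 0 \<theta>" for \<theta>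
  proof -
    define c where "c = lam / 2 * (norm (\<theta> - trunc d \<theta>))\<^sup>2"
    define J where "J \<theta> \<phi> = 0 * f \<phi> + fh \<phi> + lam / 2 * (norm (\<phi> - \<theta>))\<^sup>2" for \<theta> \<phi>
    have J: "J \<theta> \<phi> = J (trunc d \<theta>) \<phi> + c" if "\<phi> \<in> Rn d" for \<phi>
    proof -
      have "\<phi> - trunc d \<theta> \<in> Rn d"
        using that trunc_Rn subspace_Rn by (rule subspace_diff[rotated])
      then have "inner (\<phi> - trunc d \<theta>) (\<theta> - trunc d \<theta>) = 0"
        by (rule trunc_orthogonal)
      then have "(norm (\<phi> - \<theta>))\<^sup>2 = (norm (\<phi> - trunc d \<theta>))\<^sup>2 + (norm (\<theta> - trunc d \<theta>))\<^sup>2"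
        by (simp add: power2_norm_eq_inner inner_diff_left inner_diff_right inner_commute)
      then show ?thesis by (simp add: J_def c_def algebra_simps)
    qed
    have "is_arg_min (J (trunc d \<theta>)) (\<lambda>\<phi>. \<phi> \<in> Rn d) = is_arg_min (J \<theta>) (\<lambda>\<phi>. \<phi> \<in> Rn d)"
      by (auto simp: is_arg_min_def J fun_eq_iff)
    then show ?thesis
      by (simp add: inner_sol_def arg_min_on_def arg_min_def J_def[abs_def])
  qed
  then show ?thesis by (simp add: fun_on_Rn_def meta_obj_def)
qed

definition approx_sol ::
    "nat \<Rightarrow> real \<Rightarrow> (fseq \<Rightarrow> real) \<Rightarrow> (fseq \<Rightarrow> real) \<Rightarrow> real \<Rightarrow> real \<Rightarrow> fseq \<Rightarrow> fseq \<Rightarrow> bool" where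
  "approx_sol d lam f fh \<delta> \<nu> \<theta> \<psi> \<longleftrightarrow> \<psi> \<in> Rn d \<and> norm (\<psi> - inner_sol d lam f fh \<nu> \<theta>) \<le> \<delta>"

definition g_For :: "real \<Rightarrow> (real \<Rightarrow> fseq \<Rightarrow> fseq) \<Rightarrow> real \<Rightarrow> fseq \<Rightarrow> fseq" where
  "g_For lam \<psi> \<nu> \<theta> = - lam *\<^sub>R ((\<psi> \<nu> \<theta> - \<psi> 0 \<theta>) /\<^sub>R \<nu>)"

definition g_Sym :: "real \<Rightarrow> (real \<Rightarrow> fseq \<Rightarrow> fseq) \<Rightarrow> real \<Rightarrow> fseq \<Rightarrow> fseq" where
  "g_Sym lam \<psi> \<nu> \<theta> = - lam *\<^sub>R ((\<psi> \<nu> \<theta> - \<psi> (- \<nu>) \<theta>) /\<^sub>R (2 * \<nu>))"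

end

(*
  Let w solve H w = grad f at phi = sol 0 theta, where H = D^2 fh + lam * id there. Implicit
  differentiation gives grad F = lam * w and (d/dnu) sol nu theta = - w at nu = 0, so both estimators
  are difference quotients of the curve nu -> - lam * sol nu theta, and the inner error delta
  contributes lam * O(delta / nu). Rather than differentiating this curve, which need not be smooth,
  one subtracts the stationarity conditions of two solutions, tests the difference against the error
  vector itself, and uses H >= mu: the error is O(nu) for the forward quotient and O(nu^2) for the
  symmetric one.
*)
theory Submission
  imports Defs
begin

text \<open>The ambient space \<open>fseq\<close> is infinite-dimensional and incomplete, so balls
  are not compact there and functionals need not be represented by vectors. Minimizers, gradients
  and the solution w of the linear equation are therefore all produced by minimizing a coercive
  function over \<open>Rn d\<close>, whose closed balls are compact. Stationarity is known along
  \<open>Rn d\<close> only; every equation is kept in weak form, tested with vectors of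
  \<open>Rn d\<close>, and the Hessian enters as a bilinear form that is never inverted. The test
  objective need not be convex, so a perturbed solution is handled through its existence (f grows at
  most linearly, the rest quadratically) and its stationarity. Strong monotonicity of the
  unperturbed part gives an a priori distance O(\<nu>) to \<open>sol 0 \<theta>\<close>, and this
  bound turns each Taylor remainder into a power of \<nu>. The gradient of the meta-objective is
  found by duality: stationarity at a perturbed \<theta> is tested with w, so that a Lipschitz bound
  for \<open>sol 0\<close> in \<theta> is enough.\<close>

section \<open>Differential calculus in normed spaces\<close>

text \<open>One-sided, because convexity and minimality yield inequalities between difference
  quotients with \<open>t > 0\<close>, which then pass to the limit.\<close>

lemma directional_derivative:
  fixes F :: "'a::real_normed_vector \<Rightarrow> 'b::real_normed_vector"
  assumes "(F has_derivative F') (at x)"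
  shows "((\<lambda>t. (F (x + t *\<^sub>R h) - F x) /\<^sub>R t) \<longlongrightarrow> F' h) (at_right 0)"
proof -
  have "bounded_linear F'" using assms by (rule has_derivative_bounded_linear)
  then have lin: "F' (t *\<^sub>R h) = t *\<^sub>R F' h" for t by (simp add: linear_simps)
  have "((\<lambda>t. x + t *\<^sub>R h) has_derivative (\<lambda>t. t *\<^sub>R h)) (at 0)"
    by (auto intro!: derivative_eq_intros)
  from diff_chain_at[OF this, of F F'] assms
  have "((\<lambda>t. F (x + t *\<^sub>R h)) has_derivative (\<lambda>t. t *\<^sub>R F' h)) (at 0)"
    by (simp add: o_def lin)
  then have "((\<lambda>t. norm (F (x + t *\<^sub>R h) - F x - t *\<^sub>R F' h) / norm t) \<longlongrightarrow> 0) (at 0)"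
    by (simp add: has_derivative_at)
  then have "((\<lambda>t. norm (F (x + t *\<^sub>R h) - F x - t *\<^sub>R F' h) / norm t) \<longlongrightarrow> 0) (at_right 0)"
    by (rule filterlim_mono) (auto simp: at_le)
  moreover have "norm (F (x + t *\<^sub>R h) - F x - t *\<^sub>R F' h) / norm t
      = norm ((F (x + t *\<^sub>R h) - F x) /\<^sub>R t - F' h)" if "t > 0" for t
  proof -
    have "(F (x + t *\<^sub>R h) - F x) /\<^sub>R t - F' h = (F (x + t *\<^sub>R h) - F x - t *\<^sub>R F' h) /\<^sub>R t"
      using that by (simp add: scaleR_diff_right)
    then show ?thesis by (simp only: norm_scaleR) (simp add: divide_inverse mult.commute)
  qed
  then have "eventually (\<lambda>t. norm (F (x + t *\<^sub>R h) - F x - t *\<^sub>R F' h) / norm t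
      = norm ((F (x + t *\<^sub>R h) - F x) /\<^sub>R t - F' h)) (at_right 0)"
    by (auto simp: eventually_at_right_field intro: exI[of _ 1])
  ultimately have "((\<lambda>t. norm ((F (x + t *\<^sub>R h) - F x) /\<^sub>R t - F' h)) \<longlongrightarrow> 0) (at_right 0)"
    using tendsto_cong by fast
  then show ?thesis by (rule LIM_zero_cancel[OF tendsto_norm_zero_cancel])
qed

lemma norm_derivative_le_lipschitz:
  fixes F :: "'a::real_normed_vector \<Rightarrow> 'b::real_normed_vector"
  assumes lip: "K-lipschitz_on S F" and S: "subspace S" "x \<in> S" "h \<in> S"
    and D: "(F has_derivative F') (at x)"
  shows "norm (F' h) \<le> K * norm h"
proof (rule tendsto_upperbound[OF tendsto_norm[OF directional_derivative[OF D]]])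
  have "norm ((F (x + t *\<^sub>R h) - F x) /\<^sub>R t) \<le> K * norm h" if "t > 0" for t
  proof -
    have "norm (F (x + t *\<^sub>R h) - F x) \<le> K * norm (t *\<^sub>R h)"
      using lipschitz_onD[OF lip, of "x + t *\<^sub>R h" x] S
      by (simp add: dist_norm subspace_add subspace_scale)
    then have "inverse t * norm (F (x + t *\<^sub>R h) - F x) \<le> inverse t * (t * (K * norm h))"
      using that by (intro mult_left_mono) (auto simp: mult_ac)
    also have "\<dots> = K * norm h" using that by (simp flip: mult.assoc)
    finally show ?thesis using that by simp
  qed
  then show "eventually (\<lambda>t. norm ((F (x + t *\<^sub>R h) - F x) /\<^sub>R t) \<le> K * norm h) (at_right 0)"
    by (auto simp: eventually_at_right_field intro: exI[of _ 1])
qed simp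

section \<open>Taylor remainders and symmetric differences\<close>

text \<open>Mean value inequality for \<open>F\<close> minus its linearization: on the segment,
  \<open>F'\<close> moves by at most \<open>K * norm (y - x)\<close>. The factor 1/2 of the integral
  remainder is given up.\<close>

lemma lipschitz_linearization:
  fixes F :: "'a::real_normed_vector \<Rightarrow> 'b::real_normed_vector"
  assumes S: "convex S" "x \<in> S" "y \<in> S"
    and D: "\<And>z. z \<in> S \<Longrightarrow> (F has_derivative blinfun_apply (F' z)) (at z)"
    and lip: "K-lipschitz_on S F'"
  shows "norm (F y - F x - F' x (y - x)) \<le> K * (norm (y - x))\<^sup>2"
proof -
  have sub: "closed_segment x y \<subseteq> S" by (simp add: S closed_segment_subset)
  have K: "K \<ge> 0" using lip by (rule lipschitz_on_nonneg)
  have "norm (F y - F x - blinfun_apply (F' x) (y - x)) \<le> norm (y - x) * (K * norm (y - x))"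
  proof (rule differentiable_bound_linearization[where S = "closed_segment x y"])
    show "x + t *\<^sub>R (y - x) \<in> closed_segment x y" if "t \<in> {0..1}" for t
      using that by (auto simp: closed_segment_def algebra_simps intro!: exI[of _ t])
    show "(F has_derivative blinfun_apply (F' z)) (at z within closed_segment x y)"
      if "z \<in> closed_segment x y" for z
      using that sub D by (auto intro: has_derivative_at_withinI)
    show "onorm (blinfun_apply (F' z) - blinfun_apply (F' x)) \<le> K * norm (y - x)"
      if z: "z \<in> closed_segment x y" for z
    proof -
      have "onorm (blinfun_apply (F' z) - blinfun_apply (F' x)) = norm (F' z - F' x)"
        by (simp add: norm_blinfun.rep_eq minus_blinfun.rep_eq fun_diff_def)
      also have "\<dots> \<le> K * norm (z - x)"
        using lipschitz_onD[OF lip, of z x] z sub S by (auto simp: dist_norm)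
      also have "\<dots> \<le> K * norm (y - x)"
        using K z by (intro mult_left_mono) (auto dest: segment_bound1)
      finally show ?thesis .
    qed
  qed auto
  then show ?thesis by (simp add: power2_eq_square mult_ac)
qed

text \<open>The first-order terms at \<open>m + k\<close> and \<open>m - k\<close> are opposite, so
  two Taylor remainders are all that is left.\<close>

lemma second_difference_bound:
  fixes F :: "'a::real_normed_vector \<Rightarrow> 'b::real_normed_vector"
  assumes S: "convex S" "m \<in> S" "m + k \<in> S" "m - k \<in> S"
    and D: "\<And>z. z \<in> S \<Longrightarrow> (F has_derivative blinfun_apply (F' z)) (at z)"
    and lip: "K-lipschitz_on S F'"
  shows "norm (F (m + k) + F (m - k) - 2 *\<^sub>R F m) \<le> 2 * K * (norm k)\<^sup>2"
proof -
  have "F (m + k) + F (m - k) - 2 *\<^sub>R F m =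
      (F (m + k) - F m - F' m (m + k - m)) + (F (m - k) - F m - F' m (m - k - m))"
    by (simp add: blinfun.minus_right scaleR_2)
  also have "norm \<dots> \<le> K * (norm (m + k - m))\<^sup>2 + K * (norm (m - k - m))\<^sup>2"
    using S by (intro norm_triangle_mono lipschitz_linearization[OF _ _ _ D lip]) auto
  finally show ?thesis by simp
qed

text \<open>Let the step be \<open>t *\<^sub>R k\<close> with \<open>t\<close> from 0 to 1: the
  derivative in \<open>t\<close> is the second difference of \<open>F'\<close> applied to
  \<open>k\<close>. The second difference supplies the square of \<open>norm k\<close>, the
  application the third factor.\<close>

lemma central_difference_bound:
  fixes F :: "'a::real_normed_vector \<Rightarrow> 'b::real_normed_vector"
  assumes S: "subspace S" "m \<in> S" "k \<in> S"
    and D: "\<And>z. z \<in> S \<Longrightarrow> (F has_derivative blinfun_apply (F' z)) (at z)"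
    and D': "\<And>z. z \<in> S \<Longrightarrow> (F' has_derivative blinfun_apply (F'' z)) (at z)"
    and lip: "K-lipschitz_on S F''"
  shows "norm (F (m + k) - F (m - k) - 2 *\<^sub>R F' m k) \<le> 2 * K * (norm k) ^ 3"
proof -
  define \<psi> where "\<psi> t = F (m + t *\<^sub>R k) - F (m - t *\<^sub>R k) - (2 * t) *\<^sub>R F' m k" for t
  define \<psi>' where "\<psi>' t = F' (m + t *\<^sub>R k) k + F' (m - t *\<^sub>R k) k - 2 *\<^sub>R F' m k" for t
  have K: "K \<ge> 0" using lip by (rule lipschitz_on_nonneg)
  have mem: "m + t *\<^sub>R k \<in> S" "m - t *\<^sub>R k \<in> S" for t
    using S by (auto intro: subspace_add subspace_diff subspace_scale)
  have der: "(\<psi> has_derivative (\<lambda>s. s *\<^sub>R \<psi>' t)) (at t)" for t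
  proof -
    have 1: "((\<lambda>t. m + t *\<^sub>R k) has_derivative (\<lambda>s. s *\<^sub>R k)) (at t)"
      and 2: "((\<lambda>t. m - t *\<^sub>R k) has_derivative (\<lambda>s. - (s *\<^sub>R k))) (at t)"
      by (auto intro!: derivative_eq_intros)
    from diff_chain_at[OF 1 D[OF mem(1)]] diff_chain_at[OF 2 D[OF mem(2)]]
    have "((\<lambda>t. F (m + t *\<^sub>R k)) has_derivative (\<lambda>s. F' (m + t *\<^sub>R k) (s *\<^sub>R k))) (at t)"
      "((\<lambda>t. F (m - t *\<^sub>R k)) has_derivative (\<lambda>s. F' (m - t *\<^sub>R k) (- (s *\<^sub>R k)))) (at t)"
      by (simp_all add: o_def)
    then show ?thesis unfolding \<psi>_def[abs_def]
      by (rule has_derivative_diff[THEN has_derivative_diff, THEN has_derivative_eq_rhs])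
        (auto intro!: derivative_eq_intros simp: \<psi>'_def blinfun.minus_right blinfun.scaleR_right
          algebra_simps)
  qed
  have bound: "norm (\<psi>' t) \<le> 2 * K * (norm k) ^ 3" if "t \<in> {0..1}" for t
  proof -
    have "\<psi>' t = (F' (m + t *\<^sub>R k) + F' (m - t *\<^sub>R k) - 2 *\<^sub>R F' m) k"
      by (simp add: \<psi>'_def blinfun.add_left blinfun.diff_left blinfun.scaleR_left)
    also have "norm \<dots> \<le> norm (F' (m + t *\<^sub>R k) + F' (m - t *\<^sub>R k) - 2 *\<^sub>R F' m) * norm k"
      by (rule norm_blinfun)
    also have "\<dots> \<le> 2 * K * (norm (t *\<^sub>R k))\<^sup>2 * norm k"
      using S mem
      by (intro mult_right_mono second_difference_bound[OF _ _ _ _ D' lip])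
        (auto simp: subspace_imp_convex)
    also have "\<dots> \<le> 2 * K * (norm k)\<^sup>2 * norm k"
      using that K
      by (intro mult_right_mono mult_left_mono power_mono) (auto simp: mult_left_le_one_le)
    finally show ?thesis by (simp add: power2_eq_square power3_eq_cube)
  qed
  have "norm (\<psi> 1 - \<psi> 0) \<le> 2 * K * (norm k) ^ 3 * norm (1 - 0 :: real)"
  proof (rule differentiable_bound[where S = "{0..1}"])
    show "(\<psi> has_derivative (\<lambda>s. s *\<^sub>R \<psi>' t)) (at t within {0..1})" for t
      using der by (rule has_derivative_at_withinI)
    show "onorm (\<lambda>s. s *\<^sub>R \<psi>' t) \<le> 2 * K * (norm k) ^ 3" if "t \<in> {0..1}" for t
      using bound[OF that] by (intro onorm_le) (auto simp: mult.commute intro: mult_left_mono)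
  qed auto
  then show ?thesis by (simp add: \<psi>_def)
qed

text \<open>Schwarz's theorem through the mixed difference \<open>R\<close>, which is symmetric by
  construction and agrees with the second derivative up to a cubic error. Scaling both vectors by
  \<open>t\<close> leaves \<open>t\<^sup>2\<close> on the left against \<open>t ^ 3\<close> on the
  right.\<close>

lemma second_derivative_symmetric:
  fixes F :: "'a::real_normed_vector \<Rightarrow> real"
  assumes S: "subspace S" "x \<in> S" "u \<in> S" "v \<in> S"
    and D: "\<And>z. z \<in> S \<Longrightarrow> (F has_derivative blinfun_apply (F' z)) (at z)"
    and D': "\<And>z. z \<in> S \<Longrightarrow> (F' has_derivative blinfun_apply (F'' z)) (at z)"
    and lip: "K-lipschitz_on S F''"
  shows "F'' x u v = F'' x v u"
proof -
  define R where "R u v = F (x + u + v) - F (x + u) - F (x + v) + F x" for u v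
  have K: "K \<ge> 0" using lip by (rule lipschitz_on_nonneg)
  have est: "\<bar>R u v - F'' x v u\<bar> \<le> 2 * K * (norm u + norm v) ^ 3"
    if uv: "u \<in> S" "v \<in> S" for u v
  proof -
    \<comment> \<open>The total increment of \<open>\<psi>\<close> over [0,1] is
      \<open>R u v - F'' x v u\<close>: the difference in direction \<open>v\<close> is transported
      along \<open>u\<close>.\<close>
    define \<psi> where "\<psi> s = F (x + v + s *\<^sub>R u) - F (x + s *\<^sub>R u) - s * F'' x v u" for s
    define \<psi>' where "\<psi>' s = F' (x + v + s *\<^sub>R u) u - F' (x + s *\<^sub>R u) u - F'' x v u" for s
    have mem: "x + v + s *\<^sub>R u \<in> S" "x + s *\<^sub>R u \<in> S" for s
      using S uv by (auto intro: subspace_add subspace_scale)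
    have der: "(\<psi> has_derivative (\<lambda>r. r * \<psi>' s)) (at s)" for s
    proof -
      have 1: "((\<lambda>s. x + v + s *\<^sub>R u) has_derivative (\<lambda>s. s *\<^sub>R u)) (at s)"
        and 2: "((\<lambda>s. x + s *\<^sub>R u) has_derivative (\<lambda>s. s *\<^sub>R u)) (at s)"
        by (auto intro!: derivative_eq_intros)
      from diff_chain_at[OF 1 D[OF mem(1)]] diff_chain_at[OF 2 D[OF mem(2)]]
      have "((\<lambda>s. F (x + v + s *\<^sub>R u)) has_derivative (\<lambda>r. F' (x + v + s *\<^sub>R u) (r *\<^sub>R u))) (at s)"
        "((\<lambda>s. F (x + s *\<^sub>R u)) has_derivative (\<lambda>r. F' (x + s *\<^sub>R u) (r *\<^sub>R u))) (at s)"
        by (simp_all add: o_def)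
      then show ?thesis unfolding \<psi>_def[abs_def]
        by (rule has_derivative_diff[THEN has_derivative_diff, THEN has_derivative_eq_rhs])
          (auto intro!: derivative_eq_intros simp: \<psi>'_def blinfun.scaleR_right algebra_simps)
    qed
    have bound: "\<bar>\<psi>' s\<bar> \<le> 2 * K * (norm u + norm v) ^ 3" if s: "s \<in> {0..1}" for s
    proof -
      have su: "norm (s *\<^sub>R u) \<le> norm u" using s by (simp add: mult_left_le_one_le)
      have lin: "norm (F' y - F' x - F'' x (y - x)) \<le> K * (norm u + norm v)\<^sup>2"
        if "y \<in> S" "norm (y - x) \<le> norm u + norm v" for y
      proof -
        have "norm (F' y - F' x - F'' x (y - x)) \<le> K * (norm (y - x))\<^sup>2"
          using S that by (intro lipschitz_linearization[OF _ _ _ D' lip])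
            (auto simp: subspace_imp_convex)
        also have "\<dots> \<le> K * (norm u + norm v)\<^sup>2"
          using K that by (intro mult_left_mono power_mono) auto
        finally show ?thesis .
      qed
      \<comment> \<open>Both increments of \<open>F'\<close> start from the same point
        \<open>x\<close>, so the contributions of \<open>s *\<^sub>R u\<close> cancel in
        \<open>A1 - A2\<close> and \<open>F'' x v\<close> is what remains of the linear
        parts.\<close>
      define A1 where "A1 = F' (x + v + s *\<^sub>R u) - F' x - F'' x (v + s *\<^sub>R u)"
      define A2 where "A2 = F' (x + s *\<^sub>R u) - F' x - F'' x (s *\<^sub>R u)"
      have "norm A1 \<le> K * (norm u + norm v)\<^sup>2"
        using lin[of "x + v + s *\<^sub>R u"] mem[of s] su norm_triangle_ineq[of v "s *\<^sub>R u"]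
        by (simp add: A1_def add.assoc)
      moreover have "norm A2 \<le> K * (norm u + norm v)\<^sup>2"
        using lin[of "x + s *\<^sub>R u"] mem[of s] su by (simp add: A2_def add_increasing2)
      ultimately have "norm (A1 - A2) \<le> 2 * K * (norm u + norm v)\<^sup>2"
        using norm_triangle_ineq4[of A1 A2] by linarith
      then have "norm (A1 - A2) * norm u \<le> 2 * K * (norm u + norm v)\<^sup>2 * (norm u + norm v)"
        using K by (intro mult_mono) auto
      moreover have "\<psi>' s = (A1 - A2) u"
        by (simp add: \<psi>'_def A1_def A2_def blinfun.add_left blinfun.diff_left blinfun.add_right)
      ultimately show ?thesis
        using norm_blinfun[of "A1 - A2" u] by (simp add: power2_eq_square power3_eq_cube)
    qed
    have "norm (\<psi> 1 - \<psi> 0) \<le> 2 * K * (norm u + norm v) ^ 3 * norm (1 - 0 :: real)"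
    proof (rule differentiable_bound[where S = "{0..1}"])
      show "(\<psi> has_derivative (\<lambda>r. r * \<psi>' s)) (at s within {0..1})" for s
        using der by (rule has_derivative_at_withinI)
      show "onorm (\<lambda>r. r * \<psi>' s) \<le> 2 * K * (norm u + norm v) ^ 3" if "s \<in> {0..1}" for s
        using bound[OF that]
        by (intro onorm_le) (auto simp: abs_mult mult.commute intro: mult_left_mono)
    qed auto
    then show ?thesis by (simp add: \<psi>_def R_def algebra_simps)
  qed
  \<comment> \<open>The factor 4 adds the two errors of size 2 K for \<open>R u v\<close> and
    \<open>R v u\<close>.\<close>
  define c where "c = 4 * K * (norm u + norm v) ^ 3"
  have "\<bar>F'' x u v - F'' x v u\<bar> \<le> t * c" if t: "t > 0" for t
  proof -
    have tS: "t *\<^sub>R u \<in> S" "t *\<^sub>R v \<in> S" using S by (auto intro: subspace_scale)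
    have "R (t *\<^sub>R u) (t *\<^sub>R v) = R (t *\<^sub>R v) (t *\<^sub>R u)" by (simp add: R_def algebra_simps)
    then have "\<bar>F'' x (t *\<^sub>R u) (t *\<^sub>R v) - F'' x (t *\<^sub>R v) (t *\<^sub>R u)\<bar>
        \<le> 4 * K * (norm (t *\<^sub>R u) + norm (t *\<^sub>R v)) ^ 3"
      using est[OF tS] est[OF tS(2,1)] by (simp add: add.commute)
    also have "F'' x (t *\<^sub>R u) (t *\<^sub>R v) - F'' x (t *\<^sub>R v) (t *\<^sub>R u)
        = t\<^sup>2 * (F'' x u v - F'' x v u)"
      by (simp add: blinfun.scaleR_right blinfun.scaleR_left power2_eq_square algebra_simps)
    also have "norm (t *\<^sub>R u) + norm (t *\<^sub>R v) = t * (norm u + norm v)"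
      using t by (simp add: algebra_simps)
    finally have "t\<^sup>2 * \<bar>F'' x u v - F'' x v u\<bar> \<le> t\<^sup>2 * (t * c)"
      by (simp add: c_def abs_mult power_mult_distrib power2_eq_square power3_eq_cube mult_ac)
    then show ?thesis using t by simp
  qed
  then have "eventually (\<lambda>t. \<bar>F'' x u v - F'' x v u\<bar> \<le> t * c) (at_right 0)"
    unfolding eventually_at_right_field by (intro exI[of _ 1]) auto
  moreover have "((\<lambda>t. t * c) \<longlongrightarrow> 0) (at_right 0)"
    by (auto intro!: tendsto_eq_intros)
  ultimately have "\<bar>F'' x u v - F'' x v u\<bar> \<le> 0"
    by (intro tendsto_lowerbound) auto
  then show ?thesis by simp
qed

lemma bounded_bilinear_add:
  assumes "bounded_bilinear B1" "bounded_bilinear B2"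
  shows "bounded_bilinear (\<lambda>u v. B1 u v + B2 u v)"
proof -
  interpret B1: bounded_bilinear B1 by fact
  interpret B2: bounded_bilinear B2 by fact
  show ?thesis
  proof
    obtain K1 K2 where K: "\<And>u v. norm (B1 u v) \<le> norm u * norm v * K1"
      "\<And>u v. norm (B2 u v) \<le> norm u * norm v * K2"
      using B1.bounded B2.bounded by blast
    have "norm (B1 u v + B2 u v) \<le> norm u * norm v * (K1 + K2)" for u v
      using norm_triangle_mono[OF K] by (simp add: algebra_simps)
    then show "\<exists>K. \<forall>u v. norm (B1 u v + B2 u v) \<le> norm u * norm v * K" by blast
  qed (simp_all add: B1.add_left B1.add_right B2.add_left B2.add_right
      B1.scaleR_left B1.scaleR_right B2.scaleR_left B2.scaleR_right algebra_simps)
qed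

section \<open>Derivatives, gradients and stationarity\<close>

lemma has_derivative_fderiv:
  assumes "F differentiable (at x)"
  shows "(F has_derivative blinfun_apply (fderiv F x)) (at x)"
proof -
  have D: "(F has_derivative frechet_derivative F (at x)) (at x)"
    using assms by (simp add: frechet_derivative_works)
  then show ?thesis
    by (simp add: fderiv_def bounded_linear_Blinfun_apply has_derivative_bounded_linear)
qed

lemma has_derivative_quadratic_remainder:
  fixes F :: "'a::real_normed_vector \<Rightarrow> 'b::real_normed_vector"
  assumes "bounded_linear F'" "\<And>h. norm (F (x + h) - F x - F' h) \<le> K * (norm h)\<^sup>2"
  shows "(F has_derivative F') (at x)"
  unfolding has_derivative_at
proof (intro conjI assms(1))
  show "(\<lambda>h. norm (F (x + h) - F x - F' h) / norm h) \<midarrow>0\<rightarrow> 0"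
  proof (rule Lim_null_comparison)
    show "((\<lambda>h. K * norm h) \<longlongrightarrow> 0) (at 0)"
      by (auto intro!: tendsto_eq_intros)
    show "eventually (\<lambda>h. norm (norm (F (x + h) - F x - F' h) / norm h) \<le> K * norm h) (at 0)"
      using assms(2) by (auto simp: eventually_at_filter divide_simps power2_eq_square mult.assoc)
  qed
qed

lemma gradient_eqI:
  assumes "GDERIV F x :> g"
  shows "gradient F x = g"
  unfolding gradient_def
proof (rule the_equality[where P = "\<lambda>g. GDERIV F x :> g", OF assms])
  fix g' assume "GDERIV F x :> g'"
  then have "(\<lambda>h. inner h g') = (\<lambda>h. inner h g)"
    using assms unfolding gderiv_def by (rule has_derivative_unique)
  then have "inner (g' - g) (g' - g) = 0"
    by (metis inner_diff_right right_minus_eq)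
  then show "g' = g" by simp
qed

text \<open>Minimality within \<open>S\<close> makes the one-sided quotients nonnegative in
  direction \<open>h\<close> and in direction \<open>- h\<close>, and linearity forces
  equality.\<close>

lemma minimum_on_subspace_stationary:
  fixes J :: "'a::real_normed_vector \<Rightarrow> real"
  assumes S: "subspace S" "x \<in> S" "h \<in> S" and D: "(J has_derivative J') (at x)"
    and min: "\<And>y. y \<in> S \<Longrightarrow> J x \<le> J y"
  shows "J' h = 0"
proof -
  have ge: "J' h \<ge> 0" if h: "h \<in> S" for h
  proof (rule tendsto_lowerbound[OF directional_derivative[OF D]])
    show "eventually (\<lambda>t. 0 \<le> (J (x + t *\<^sub>R h) - J x) /\<^sub>R t) (at_right 0)"
      using S h min
      by (auto simp: eventually_at_right_field subspace_add subspace_scale intro!: exI[of _ 1])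
  qed simp
  have "J' (- h) = - J' h"
    using has_derivative_bounded_linear[OF D] by (simp add: linear_simps)
  then show ?thesis using ge[of h] ge[of "- h"] S by (simp add: subspace_neg)
qed

section \<open>The subspaces \<open>Rn d\<close>\<close>

lemma closed_Rn: "closed (Rn d)"
proof -
  have "Rn d = {x. trunc d x = x}"
    using trunc_Rn trunc_id by (metis (mono_tags, lifting) Collect_cong Collect_mem_eq)
  moreover have "continuous_on UNIV (trunc d)"
    using bounded_linear_trunc by (rule linear_continuous_on)
  ultimately show ?thesis by (simp add: closed_Collect_eq continuous_on_id)
qed

text \<open>Heine-Borel by induction on the dimension. A ball in the next dimension is a closed
  subset of the continuous image of a lower-dimensional ball times an interval.\<close>

lemma compact_Rn_cball: "compact (Rn d \<inter> cball 0 r)"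
proof (induction d)
  case 0
  have "Rn 0 = {0}" by (auto simp: Rn_def intro: fseq_eqI)
  then show ?case by (simp add: finite_imp_compact)
next
  case (Suc d)
  \<comment> \<open>The unit vector of the new coordinate, which has index \<open>d\<close>. That
    coordinate of \<open>x\<close> is an inner product with \<open>e\<close>, hence bounded by the
    radius.\<close>
  obtain e where e: "e \<in> Rn (Suc d)" "\<forall>i<Suc d. coord e i = (if i = d then 1 else 0)"
    using coord_surj_Rn[of "Suc d" "\<lambda>i. if i = d then 1 else 0"] by auto
  define g where "g p = fst p + snd p *\<^sub>R e" for p :: "fseq \<times> real"
  define Q where "Q = g ` ((Rn d \<inter> cball 0 r) \<times> {- r..r})"
  have "compact Q" unfolding Q_def g_def
    by (intro compact_continuous_image compact_Times Suc.IH compact_Icc continuous_intros)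
  moreover have "Rn (Suc d) \<inter> cball 0 r \<subseteq> Q"
  proof safe
    fix x assume x: "x \<in> Rn (Suc d)" "x \<in> cball 0 r"
    have "coord x d = inner e x"
      using e by (simp add: inner_Rn[OF e(1)] if_distrib[of "\<lambda>a. a * _"] cong: if_cong)
    moreover have "norm e = 1"
      using e by (simp add: norm_eq_sqrt_inner inner_Rn[OF e(1)] if_distrib[of "\<lambda>a. a * _"] cong: if_cong)
    ultimately have "\<bar>coord x d\<bar> \<le> r"
      using Cauchy_Schwarz_ineq2[of e x] x(2) by simp
    moreover have "trunc d x \<in> Rn d \<inter> cball 0 r"
      using x(2) norm_trunc_le[of d x] by (simp add: trunc_Rn)
    moreover have "x = g (trunc d x, coord x d)"
    proof (rule fseq_eqI)
      fix i
      show "coord x i = coord (g (trunc d x, coord x d)) i"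
        using e x(1) by (cases i d rule: linorder_cases) (auto simp: g_def coord_trunc Rn_def)
    qed
    ultimately show "x \<in> Q" unfolding Q_def
      by (intro image_eqI[of _ _ "(trunc d x, coord x d)"]) (auto simp: abs_le_iff)
  qed
  ultimately show ?case
    by (metis closed_Int closed_Rn closed_cball compact_Int_closed inf.absorb_iff2)
qed

lemma coercive_attains_min_Rn:
  assumes cont: "continuous_on (Rn d) J" and a: "a > 0"
    and coercive: "\<And>x. x \<in> Rn d \<Longrightarrow> J x \<ge> J 0 + a * (norm x)\<^sup>2 - b * norm x"
  shows "\<exists>x\<in>Rn d. \<forall>y\<in>Rn d. J x \<le> (J y :: real)"
proof -
  \<comment> \<open>Beyond this radius the quadratic term outweighs the linear one and
    \<open>J\<close> is at least \<open>J 0\<close>. Since 0 lies in the ball, a minimum over the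
    ball is a minimum over \<open>Rn d\<close>.\<close>
  define r where "r = \<bar>b\<bar> / a"
  have "r \<ge> 0" using a by (simp add: r_def)
  then have "0 \<in> Rn d \<inter> cball 0 r" using subspace_Rn by (simp add: subspace_0)
  moreover have "continuous_on (Rn d \<inter> cball 0 r) J"
    using cont by (rule continuous_on_subset) auto
  ultimately obtain x where x: "x \<in> Rn d \<inter> cball 0 r" "\<forall>y\<in>Rn d \<inter> cball 0 r. J x \<le> J y"
    using continuous_attains_inf[OF compact_Rn_cball] by blast
  have "J x \<le> J y" if y: "y \<in> Rn d" for y
  proof (cases "norm y \<le> r")
    case True
    then show ?thesis using x y by auto
  next
    case False
    then have "b \<le> a * norm y" using a by (simp add: r_def field_simps)
    then have "b * norm y \<le> a * norm y * norm y" by (intro mult_right_mono) auto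
    then have "J 0 \<le> J y" using coercive[OF y] by (simp add: power2_eq_square mult.assoc)
    then show ?thesis using x \<open>0 \<in> Rn d \<inter> cball 0 r\<close> by (meson order_trans)
  qed
  then show ?thesis using x by auto
qed

text \<open>The solution is the minimizer of the energy \<open>B u u / 2 - l u\<close>. Symmetry
  turns the averaged derivative \<open>(B h w + B w h) / 2\<close> into \<open>B w h\<close>;
  compactness in \<open>Rn d\<close> takes the place of completeness.\<close>

lemma symmetric_lax_milgram_Rn:
  fixes B :: "fseq \<Rightarrow> fseq \<Rightarrow> real" and l :: "fseq \<Rightarrow>\<^sub>L real"
  assumes B: "bounded_bilinear B"
    and sym: "\<And>u v. u \<in> Rn d \<Longrightarrow> v \<in> Rn d \<Longrightarrow> B u v = B v u"
    and coercive: "a > 0" "\<And>u. u \<in> Rn d \<Longrightarrow> B u u \<ge> a * (norm u)\<^sup>2"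
  shows "\<exists>w\<in>Rn d. \<forall>h\<in>Rn d. B w h = l h"
proof -
  define J where "J u = B u u / 2 - l u" for u
  have der: "(J has_derivative (\<lambda>h. (B h u + B u h) / 2 - l h)) (at u)" for u
    unfolding J_def[abs_def]
    by (auto intro!: derivative_eq_intros bounded_bilinear.FDERIV[OF B] simp: add.commute)
  have "\<exists>u\<in>Rn d. \<forall>v\<in>Rn d. J u \<le> J v"
  proof (rule coercive_attains_min_Rn)
    show "continuous_on (Rn d) J" unfolding J_def[abs_def] by (intro continuous_intros bounded_bilinear.continuous_on[OF B]) auto
    show "J u \<ge> J 0 + a / 2 * (norm u)\<^sup>2 - norm l * norm u" if "u \<in> Rn d" for u
      using coercive(2)[OF that] norm_blinfun[of l u] by (simp add: J_def bounded_bilinear.zero_left[OF B])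
  qed (use coercive in auto)
  then obtain w where w: "w \<in> Rn d" "\<forall>v\<in>Rn d. J w \<le> J v" by blast
  have "B w h = l h" if h: "h \<in> Rn d" for h
    using minimum_on_subspace_stationary[OF subspace_Rn w(1) h der] w(2) sym[OF w(1) h] by simp
  then show ?thesis using w(1) by blast
qed

text \<open>Since \<open>gradient\<close> is a definite description, a representing vector must be
  exhibited. It is found inside \<open>Rn d\<close> by solving with the inner product as bilinear
  form, and it represents the derivative in all ambient directions because both sides ignore the
  component orthogonal to \<open>Rn d\<close>.\<close>

lemma gradient_fun_on_Rn:
  assumes f: "fun_on_Rn d f" and x: "x \<in> Rn d" and D: "f differentiable (at x)"
  shows "fderiv f x h = inner (gradient f x) h"
proof -
  note der = has_derivative_fderiv[OF D]
  have tr: "fderiv f x (trunc d h) = fderiv f x h" for h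
    using has_derivative_fun_on_Rn[OF f x] der by blast
  have "\<exists>w\<in>Rn d. \<forall>h\<in>Rn d. inner w h = fderiv f x h"
    by (rule symmetric_lax_milgram_Rn[OF bounded_bilinear_inner, of d 1])
      (auto simp: inner_commute power2_norm_eq_inner)
  then obtain w where w: "w \<in> Rn d" "\<And>h. h \<in> Rn d \<Longrightarrow> inner h w = fderiv f x h"
    by (auto simp: inner_commute)
  have "fderiv f x h = inner h w" for h
  proof -
    have "inner w h = inner w (trunc d h)"
      using trunc_orthogonal[OF w(1), of h] by (simp add: inner_diff_right)
    then show ?thesis
      using w(2)[OF trunc_Rn[of d h]] tr[of h] by (simp add: inner_commute)
  qed
  then have "GDERIV f x :> w"
    using der unfolding gderiv_def by (metis (no_types, lifting) ext)
  then show ?thesis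
    using \<open>\<And>h. fderiv f x h = inner h w\<close> by (simp add: gradient_eqI inner_commute)
qed

section \<open>The regularized inner problem\<close>

text \<open>A single task. The final error bounds proved here are expressed through the constants,
  \<nu> and \<delta> alone, which yields uniformity in the dimension, the number of tasks and
  \<theta>.\<close>

locale inner_problem =
  fixes d :: nat and lam \<mu> L0 L1 Lh1 Lh2 :: real and f fh :: "fseq \<Rightarrow> real"
  assumes lam: "0 < lam" and mu: "0 < \<mu>"
    and f_fun: "fun_on_Rn d f"
    and train: "train_regular d Lh1 Lh2 fh" and test: "test_regular d L0 L1 f"
    and convex: "train_strongly_convex d lam \<mu> fh"
begin

abbreviation sol :: "real \<Rightarrow> fseq \<Rightarrow> fseq" where
  "sol \<equiv> inner_sol d lam f fh"

text \<open>The centre \<theta> of the regularizer contributes only an affine term, so one form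
  serves the inner problems for all \<theta>.\<close>

definition hess :: "fseq \<Rightarrow> fseq \<Rightarrow> fseq \<Rightarrow> real" where
  "hess x u v = D2 fh x u v + lam * inner u v"

lemma constants_nonneg: "0 \<le> L0" "0 \<le> L1" "0 \<le> Lh2"
  using train test
  by (auto simp: train_regular_def test_regular_def L_smooth_def dest: lipschitz_on_nonneg)

lemma convex_Rn: "convex (Rn d)"
  using subspace_Rn by (rule subspace_imp_convex)

lemmas Rn_intros = subspace_add[OF subspace_Rn] subspace_diff[OF subspace_Rn]
  subspace_scale[OF subspace_Rn] subspace_0[OF subspace_Rn]

lemma
  assumes "x \<in> Rn d"
  shows D1_f: "(f has_derivative blinfun_apply (D1 f x)) (at x)"
    and D1_fh: "(fh has_derivative blinfun_apply (D1 fh x)) (at x)"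
    and D2_fh: "(D1 fh has_derivative blinfun_apply (D2 fh x)) (at x)"
  using train test assms
  by (auto simp: train_regular_def test_regular_def diff_on_Rn_def intro: has_derivative_fderiv)

text \<open>Smoothness is stated for gradients while the estimates use functionals; by
  Cauchy-Schwarz a functional is no larger than its representing vector.\<close>

lemma lipschitz_D1_f: "L1-lipschitz_on (Rn d) (D1 f)"
proof (rule lipschitz_onI)
  fix x y assume xy: "x \<in> Rn d" "y \<in> Rn d"
  have "norm (D1 f x - D1 f y) \<le> norm (gradient f x - gradient f y)"
  proof (rule norm_blinfun_bound)
    fix h
    have "(D1 f x - D1 f y) h = inner (gradient f x - gradient f y) h"
      using xy test gradient_fun_on_Rn[OF f_fun]
      by (simp add: blinfun.diff_left inner_diff_left test_regular_def diff_on_Rn_def)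
    then show "norm ((D1 f x - D1 f y) h) \<le> norm (gradient f x - gradient f y) * norm h"
      by (simp add: Cauchy_Schwarz_ineq2)
  qed simp
  also have "\<dots> \<le> L1 * dist x y"
    using xy test lipschitz_onD[of L1 "Rn d" "gradient f"]
    by (auto simp: test_regular_def L_smooth_def dist_norm)
  finally show "dist (D1 f x) (D1 f y) \<le> L1 * dist x y" by (simp add: dist_norm)
qed (rule constants_nonneg)

lemma lipschitz_D2_fh: "Lh2-lipschitz_on (Rn d) (D2 fh)"
  using train by (simp add: train_regular_def)

lemma D1_f_bound:
  assumes "x \<in> Rn d" "h \<in> Rn d"
  shows "\<bar>D1 f x h\<bar> \<le> L0 * norm h"
proof -
  have "L0-lipschitz_on (Rn d) f" using test by (simp add: test_regular_def)
  from norm_derivative_le_lipschitz[OF this subspace_Rn assms D1_f] assms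
  show ?thesis by simp
qed

lemma D1_f_diff_bound:
  assumes "x \<in> Rn d" "y \<in> Rn d"
  shows "\<bar>D1 f y h - D1 f x h\<bar> \<le> L1 * norm (y - x) * norm h"
proof -
  have "\<bar>D1 f y h - D1 f x h\<bar> \<le> norm (D1 f y - D1 f x) * norm h"
    using norm_blinfun[of "D1 f y - D1 f x" h] by (simp add: blinfun.diff_left)
  also have "\<dots> \<le> L1 * norm (y - x) * norm h"
    using lipschitz_onD[OF lipschitz_D1_f assms(2,1)] by (auto simp: dist_norm intro: mult_right_mono)
  finally show ?thesis .
qed

lemma f_linearization:
  assumes "x \<in> Rn d" "y \<in> Rn d"
  shows "\<bar>f y - f x - D1 f x (y - x)\<bar> \<le> L1 * (norm (y - x))\<^sup>2"
  using lipschitz_linearization[OF convex_Rn assms D1_f lipschitz_D1_f] by simp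

lemma D1_fh_linearization:
  assumes "x \<in> Rn d" "y \<in> Rn d"
  shows "\<bar>D1 fh y h - D1 fh x h - D2 fh x (y - x) h\<bar> \<le> Lh2 * (norm (y - x))\<^sup>2 * norm h"
proof -
  have "\<bar>D1 fh y h - D1 fh x h - D2 fh x (y - x) h\<bar>
      \<le> norm (D1 fh y - D1 fh x - D2 fh x (y - x)) * norm h"
    using norm_blinfun[of "D1 fh y - D1 fh x - D2 fh x (y - x)" h]
    by (simp add: blinfun.diff_left)
  also have "\<dots> \<le> Lh2 * (norm (y - x))\<^sup>2 * norm h"
    by (intro mult_right_mono lipschitz_linearization[OF convex_Rn assms D2_fh lipschitz_D2_fh]) auto
  finally show ?thesis .
qed

section \<open>Consequences of strong convexity\<close>

text \<open>Divide the chord inequality by \<open>t\<close> and let \<open>t\<close> tend to 0; the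
  factor \<open>1 - t\<close> tends to 1 and leaves the full quadratic gain.\<close>

lemma first_order_convexity:
  assumes x: "x \<in> Rn d" and y: "y \<in> Rn d"
  shows "D1 fh x (y - x) + lam * inner x (y - x)
    \<le> (fh y + lam / 2 * (norm y)\<^sup>2) - (fh x + lam / 2 * (norm x)\<^sup>2) - \<mu> / 2 * (norm (y - x))\<^sup>2"
proof -
  define g where "g z = fh z + lam / 2 * (norm z)\<^sup>2" for z
  have D: "(g has_derivative (\<lambda>h. D1 fh x h + lam * inner x h)) (at x)"
    unfolding g_def[abs_def] power2_norm_eq_inner
    by (auto intro!: derivative_eq_intros D1_fh[OF x] simp: inner_commute)
  have "(g (x + t *\<^sub>R (y - x)) - g x) /\<^sub>R t \<le> g y - g x - \<mu> / 2 * (1 - t) * (norm (y - x))\<^sup>2"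
    if t: "0 < t" "t < 1" for t
  proof -
    have "g ((1 - t) *\<^sub>R x + t *\<^sub>R y)
        \<le> (1 - t) * g x + t * g y - \<mu> / 2 * t * (1 - t) * (norm (x - y))\<^sup>2"
      using convex x y t
      by (auto simp: train_strongly_convex_def strongly_convex_on_def g_def)
    moreover have "(1 - t) *\<^sub>R x + t *\<^sub>R y = x + t *\<^sub>R (y - x)" by (simp add: algebra_simps)
    ultimately have "g (x + t *\<^sub>R (y - x)) - g x
        \<le> t * (g y - g x - \<mu> / 2 * (1 - t) * (norm (y - x))\<^sup>2)"
      by (simp add: algebra_simps norm_minus_commute)
    then show ?thesis using t by (simp add: divide_simps mult.commute)
  qed
  then have "eventually (\<lambda>t. (g (x + t *\<^sub>R (y - x)) - g x) /\<^sub>R t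
      \<le> g y - g x - \<mu> / 2 * (1 - t) * (norm (y - x))\<^sup>2) (at_right 0)"
    unfolding eventually_at_right_field by (intro exI[of _ 1]) auto
  moreover have "((\<lambda>t. g y - g x - \<mu> / 2 * (1 - t) * (norm (y - x))\<^sup>2) \<longlongrightarrow>
      g y - g x - \<mu> / 2 * (norm (y - x))\<^sup>2) (at_right 0)"
    by (auto intro!: tendsto_eq_intros)
  ultimately show ?thesis
    using directional_derivative[OF D, of "y - x"]
    by (intro tendsto_le[of "at_right 0"]) (auto simp: g_def)
qed

text \<open>Add the tangent inequalities at \<open>x\<close> and at \<open>y\<close>: the function
  values cancel and the two halves of \<open>\<mu>\<close> combine.\<close>

lemma strong_monotonicity:
  assumes "x \<in> Rn d" "y \<in> Rn d"
  shows "\<mu> * (norm (y - x))\<^sup>2 \<le> D1 fh y (y - x) - D1 fh x (y - x) + lam * (norm (y - x))\<^sup>2"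
proof -
  have "lam * (norm (y - x))\<^sup>2 = lam * inner y (y - x) - lam * inner x (y - x)"
    by (simp add: power2_norm_eq_inner inner_diff_left algebra_simps)
  moreover have "D1 fh y (x - y) = - D1 fh y (y - x)" "inner y (x - y) = - inner y (y - x)"
    by (simp_all add: blinfun.diff_right inner_diff_right)
  ultimately show ?thesis
    using first_order_convexity[OF assms] first_order_convexity[OF assms(2,1)]
    by (simp add: norm_minus_commute)
qed

lemma bounded_bilinear_hess: "bounded_bilinear (hess x)"
proof -
  have "bounded_bilinear (\<lambda>u v. D2 fh x u v)"
    by (rule bounded_bilinear.comp1[OF bounded_bilinear_blinfun_apply])
      (rule blinfun.bounded_linear_right)
  moreover have "bounded_bilinear (\<lambda>u v. inner (lam *\<^sub>R u) v)"
    by (rule bounded_bilinear.comp1[OF bounded_bilinear_inner bounded_linear_scaleR_right])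
  ultimately have "bounded_bilinear (\<lambda>u v. D2 fh x u v + inner (lam *\<^sub>R u) v)"
    by (rule bounded_bilinear_add)
  then show ?thesis by (simp add: hess_def[abs_def])
qed

text \<open>Strong monotonicity between \<open>x\<close> and \<open>x + t *\<^sub>R z\<close>,
  divided by the square of \<open>t\<close>, in the limit \<open>t\<close> to 0.\<close>

lemma hess_coercive:
  assumes x: "x \<in> Rn d" and z: "z \<in> Rn d"
  shows "\<mu> * (norm z)\<^sup>2 \<le> hess x z z"
proof -
  have "\<mu> * (norm z)\<^sup>2 - lam * (norm z)\<^sup>2 \<le> ((D1 fh (x + t *\<^sub>R z) - D1 fh x) /\<^sub>R t) z"
    if t: "0 < t" for t
  proof -
    have "\<mu> * (t\<^sup>2 * (norm z)\<^sup>2)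
        \<le> t * (D1 fh (x + t *\<^sub>R z) z - D1 fh x z) + lam * (t\<^sup>2 * (norm z)\<^sup>2)"
      using strong_monotonicity[of x "x + t *\<^sub>R z"] x z t
      by (simp add: Rn_intros blinfun.scaleR_right power_mult_distrib algebra_simps)
    then have "t * (t * (\<mu> * (norm z)\<^sup>2 - lam * (norm z)\<^sup>2))
        \<le> t * (D1 fh (x + t *\<^sub>R z) z - D1 fh x z)"
      by (simp add: power2_eq_square algebra_simps)
    then show ?thesis
      using t by (simp add: blinfun.scaleR_left blinfun.diff_left divide_simps mult.commute)
  qed
  then have "eventually (\<lambda>t. \<mu> * (norm z)\<^sup>2 - lam * (norm z)\<^sup>2
      \<le> ((D1 fh (x + t *\<^sub>R z) - D1 fh x) /\<^sub>R t) z) (at_right 0)"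
    unfolding eventually_at_right_field by (intro exI[of _ 1]) auto
  moreover have "((\<lambda>t. ((D1 fh (x + t *\<^sub>R z) - D1 fh x) /\<^sub>R t) z) \<longlongrightarrow> D2 fh x z z) (at_right 0)"
    by (intro tendsto_intros directional_derivative[OF D2_fh[OF x]])
  ultimately have "\<mu> * (norm z)\<^sup>2 - lam * (norm z)\<^sup>2 \<le> D2 fh x z z"
    by (intro tendsto_lowerbound) auto
  then show ?thesis by (simp add: hess_def power2_norm_eq_inner)
qed

lemma hess_symmetric:
  assumes "x \<in> Rn d" "u \<in> Rn d" "v \<in> Rn d"
  shows "hess x u v = hess x v u"
  using second_derivative_symmetric[OF subspace_Rn assms D1_fh D2_fh lipschitz_D2_fh]
  by (simp add: hess_def inner_commute)

text \<open>The common last step of both expansions, with \<open>p\<close> the error vector: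
  coercivity is quadratic in \<open>norm p\<close>, the tested residual only linear.\<close>

lemma norm_le_of_hess_le:
  assumes "x \<in> Rn d" "p \<in> Rn d" "hess x p p \<le> c * norm p" "0 \<le> c"
  shows "norm p \<le> c / \<mu>"
proof (cases "p = 0")
  case False
  have "\<mu> * norm p * norm p \<le> c * norm p"
    using hess_coercive[OF assms(1,2)] assms(3) by (simp add: power2_eq_square)
  then show ?thesis using False mu by (simp add: field_simps)
qed (use assms mu in simp)

section \<open>Inner solutions and their dependence on the parameters\<close>

text \<open>Strong convexity supplies quadratic growth, while \<nu> f grows at most linearly because
  f is Lipschitz. Hence a minimizer exists for every real \<nu>, even where the perturbed objective
  fails to be convex.\<close>

lemma
  assumes \<theta>: "\<theta> \<in> Rn d"
  shows sol_Rn: "sol \<nu> \<theta> \<in> Rn d"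
    and sol_stationary: "h \<in> Rn d \<Longrightarrow>
      \<nu> * D1 f (sol \<nu> \<theta>) h + D1 fh (sol \<nu> \<theta>) h + lam * inner (sol \<nu> \<theta> - \<theta>) h = 0"
proof -
  define J where "J \<phi> = \<nu> * f \<phi> + fh \<phi> + lam / 2 * (norm (\<phi> - \<theta>))\<^sup>2" for \<phi>
  have D: "(J has_derivative (\<lambda>h. \<nu> * D1 f x h + D1 fh x h + lam * inner (x - \<theta>) h)) (at x)"
    if "x \<in> Rn d" for x
    unfolding J_def[abs_def] power2_norm_eq_inner
    by (auto intro!: derivative_eq_intros D1_fh[OF that] D1_f[OF that] simp: inner_commute)
  have "\<exists>x\<in>Rn d. \<forall>y\<in>Rn d. J x \<le> J y"
  proof (rule coercive_attains_min_Rn)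
    show "continuous_on (Rn d) J"
      using D by (intro continuous_at_imp_continuous_on) (auto dest: has_derivative_continuous)
    \<comment> \<open>The three linear coefficients come from the Lipschitz constant of f, the slope
      of \<open>fh\<close> at 0, and the cross term in the expansion of the squared distance to
      \<theta>.\<close>
    show "J x \<ge> J 0 + \<mu> / 2 * (norm x)\<^sup>2 - (\<bar>\<nu>\<bar> * L0 + norm (D1 fh 0) + lam * norm \<theta>) * norm x"
      if x: "x \<in> Rn d" for x
    proof -
      have "D1 fh 0 x \<le> fh x + lam / 2 * (norm x)\<^sup>2 - fh 0 - \<mu> / 2 * (norm x)\<^sup>2"
        using first_order_convexity[of 0 x] x by (simp add: Rn_intros)
      moreover have "\<bar>D1 fh 0 x\<bar> \<le> norm (D1 fh 0) * norm x"
        using norm_blinfun[of "D1 fh 0" x] by simp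
      moreover have "\<bar>\<nu> * f x - \<nu> * f 0\<bar> \<le> \<bar>\<nu>\<bar> * L0 * norm x"
      proof -
        have "\<bar>f x - f 0\<bar> \<le> L0 * norm x"
          using test x lipschitz_onD[of L0 "Rn d" f x 0]
          by (simp add: test_regular_def dist_norm Rn_intros)
        then have "\<bar>\<nu>\<bar> * \<bar>f x - f 0\<bar> \<le> \<bar>\<nu>\<bar> * (L0 * norm x)" by (rule mult_left_mono) simp
        then show ?thesis by (simp add: abs_mult[symmetric] algebra_simps)
      qed
      moreover have "lam * inner x \<theta> \<le> lam * (norm \<theta> * norm x)"
        using lam norm_cauchy_schwarz[of x \<theta>] by (simp add: mult.commute)
      moreover have "lam / 2 * (norm (x - \<theta>))\<^sup>2
          = lam / 2 * (norm x)\<^sup>2 + lam / 2 * (norm \<theta>)\<^sup>2 - lam * inner x \<theta>"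
        by (simp add: power2_norm_eq_inner inner_diff_left inner_diff_right inner_commute field_simps)
      ultimately show ?thesis
        unfolding J_def by (simp add: algebra_simps abs_le_iff)
    qed
  qed (use mu in auto)
  then obtain x where x: "x \<in> Rn d" "\<forall>y\<in>Rn d. J x \<le> J y" by blast
  \<comment> \<open>\<open>inner_sol\<close> is a choice among minimizers, so the existence of one
    transfers its properties to the chosen one.\<close>
  then have "is_arg_min J (\<lambda>\<phi>. \<phi> \<in> Rn d) x" by (auto simp: is_arg_min_def not_less)
  then have "is_arg_min J (\<lambda>\<phi>. \<phi> \<in> Rn d) (sol \<nu> \<theta>)"
    unfolding inner_sol_def arg_min_on_def arg_min_def J_def[abs_def] by (rule someI)
  then have *: "sol \<nu> \<theta> \<in> Rn d" "\<And>y. y \<in> Rn d \<Longrightarrow> J (sol \<nu> \<theta>) \<le> J y"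
    by (auto simp: is_arg_min_def not_less)
  show "sol \<nu> \<theta> \<in> Rn d" by (fact *)
  show "\<nu> * D1 f (sol \<nu> \<theta>) h + D1 fh (sol \<nu> \<theta>) h + lam * inner (sol \<nu> \<theta> - \<theta>) h = 0"
    if h: "h \<in> Rn d"
    by (rule minimum_on_subspace_stationary[OF subspace_Rn *(1) h D[OF *(1)] *(2)])
qed

text \<open>By the implicit function theorem, \<open>- sens \<theta>\<close> is the derivative of \<open>\<nu> \<mapsto> sol \<nu> \<theta>\<close> at \<open>0\<close>.\<close>

definition sens :: "fseq \<Rightarrow> fseq" where
  "sens \<theta> = (SOME w. w \<in> Rn d \<and> (\<forall>h\<in>Rn d. hess (sol 0 \<theta>) w h = D1 f (sol 0 \<theta>) h))"

lemma
  assumes \<theta>: "\<theta> \<in> Rn d"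
  shows sens_Rn: "sens \<theta> \<in> Rn d"
    and hess_sens: "h \<in> Rn d \<Longrightarrow> hess (sol 0 \<theta>) (sens \<theta>) h = D1 f (sol 0 \<theta>) h"
proof -
  have "\<exists>w. w \<in> Rn d \<and> (\<forall>h\<in>Rn d. hess (sol 0 \<theta>) w h = D1 f (sol 0 \<theta>) h)"
    using symmetric_lax_milgram_Rn[OF bounded_bilinear_hess hess_symmetric[OF sol_Rn[OF \<theta>]] mu
        hess_coercive[OF sol_Rn[OF \<theta>]]] by blast
  from someI_ex[OF this] show "sens \<theta> \<in> Rn d"
    "h \<in> Rn d \<Longrightarrow> hess (sol 0 \<theta>) (sens \<theta>) h = D1 f (sol 0 \<theta>) h"
    by (auto simp: sens_def)
qed

text \<open>Subtract the two stationarity conditions and test with \<open>z\<close>. Since the base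
  point has parameter 0, the test objective enters only through its derivative at \<open>y\<close>,
  which \<open>L0\<close> controls. With equal \<theta> this is the bound in \<nu>, with \<nu> = 0
  the bound in \<theta>.\<close>

lemma sol_lipschitz:
  assumes \<theta>: "\<theta> \<in> Rn d" "\<theta>' \<in> Rn d"
  shows "norm (sol \<nu> \<theta>' - sol 0 \<theta>) \<le> (\<bar>\<nu>\<bar> * L0 + lam * norm (\<theta>' - \<theta>)) / \<mu>"
proof -
  define x y z where "x = sol 0 \<theta>" and "y = sol \<nu> \<theta>'" and "z = y - x"
  have Rn: "x \<in> Rn d" "y \<in> Rn d" "z \<in> Rn d"
    using \<theta> by (auto simp: x_def y_def z_def sol_Rn Rn_intros)
  have eq: "D1 fh y z - D1 fh x z + lam * (norm z)\<^sup>2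
      = - (\<nu> * D1 f y z) + lam * inner (\<theta>' - \<theta>) z"
    using sol_stationary[OF \<theta>(1) Rn(3), of 0] sol_stationary[OF \<theta>(2) Rn(3), of \<nu>]
    by (simp add: x_def[symmetric] y_def[symmetric] power2_norm_eq_inner)
      (simp add: z_def inner_diff_left algebra_simps)
  have "\<bar>\<nu> * D1 f y z\<bar> \<le> \<bar>\<nu>\<bar> * (L0 * norm z)"
    using D1_f_bound[OF Rn(2,3)] by (simp add: abs_mult mult_left_mono)
  moreover have "lam * inner (\<theta>' - \<theta>) z \<le> lam * (norm (\<theta>' - \<theta>) * norm z)"
    using lam norm_cauchy_schwarz by (intro mult_left_mono) auto
  moreover have "\<mu> * (norm z)\<^sup>2 \<le> D1 fh y z - D1 fh x z + lam * (norm z)\<^sup>2"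
    using strong_monotonicity[OF Rn(1,2)] by (simp add: z_def)
  ultimately have "\<mu> * norm z * norm z \<le> (\<bar>\<nu>\<bar> * L0 + lam * norm (\<theta>' - \<theta>)) * norm z"
    unfolding eq by (simp add: algebra_simps power2_eq_square abs_le_iff)
  then have "norm z = 0 \<or> \<mu> * norm z \<le> \<bar>\<nu>\<bar> * L0 + lam * norm (\<theta>' - \<theta>)"
    by (auto simp: mult_le_cancel_right)
  moreover have "0 \<le> \<bar>\<nu>\<bar> * L0 + lam * norm (\<theta>' - \<theta>)" using constants_nonneg lam by auto
  ultimately have "norm z \<le> (\<bar>\<nu>\<bar> * L0 + lam * norm (\<theta>' - \<theta>)) / \<mu>"
    using mu by (auto simp: field_simps)
  then show ?thesis by (simp add: z_def x_def y_def)
qed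

text \<open>Stationarity and the equation for \<open>sens\<close> remove all first-order terms from
  \<open>hess x p p\<close>. There remain a Taylor remainder of \<open>D1 fh\<close> and \<nu> times
  the change of \<open>D1 f\<close>, both quadratic in \<nu>. The sign of \<nu> is free, so the
  bound can be used at both ends of the symmetric quotient.\<close>

lemma sol_expansion:
  assumes \<theta>: "\<theta> \<in> Rn d"
  shows "norm (sol \<nu> \<theta> - sol 0 \<theta> + \<nu> *\<^sub>R sens \<theta>)
    \<le> (Lh2 * (L0 / \<mu>)\<^sup>2 + L1 * (L0 / \<mu>)) / \<mu> * \<nu>\<^sup>2"
proof -
  define x y z p where "x = sol 0 \<theta>" and "y = sol \<nu> \<theta>" and "z = y - x"
    and "p = z + \<nu> *\<^sub>R sens \<theta>"
  \<comment> \<open>The rate at which solutions leave \<open>sol 0 \<theta>\<close>, from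
    \<open>sol_lipschitz\<close>.\<close>
  define a where "a = L0 / \<mu>"
  define c where "c = (Lh2 * a\<^sup>2 + L1 * a) * \<nu>\<^sup>2"
  have a: "a \<ge> 0" using constants_nonneg mu by (simp add: a_def)
  have Rn: "x \<in> Rn d" "y \<in> Rn d" "z \<in> Rn d" "p \<in> Rn d"
    using \<theta> by (auto simp: x_def y_def z_def p_def sol_Rn sens_Rn Rn_intros)
  have z: "norm z \<le> \<bar>\<nu>\<bar> * a"
    using sol_lipschitz[OF \<theta> \<theta>, of \<nu>] by (simp add: z_def x_def y_def a_def)
  have "hess x p p = hess x z p + \<nu> * hess x (sens \<theta>) p"
    by (simp add: hess_def p_def blinfun.add_left blinfun.add_right blinfun.scaleR_left
        blinfun.scaleR_right inner_add_left algebra_simps)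
  also have "hess x (sens \<theta>) p = D1 f x p"
    using hess_sens[OF \<theta> Rn(4)] by (simp add: x_def)
  also have "hess x z p + \<nu> * D1 f x p
      = - (D1 fh y p - D1 fh x p - D2 fh x (y - x) p) - \<nu> * (D1 f y p - D1 f x p)"
    using sol_stationary[OF \<theta> Rn(4), of 0] sol_stationary[OF \<theta> Rn(4), of \<nu>]
    by (simp add: x_def[symmetric] y_def[symmetric] hess_def)
      (simp add: z_def inner_diff_left algebra_simps)
  also have "\<dots> \<le> Lh2 * (norm z)\<^sup>2 * norm p + \<bar>\<nu>\<bar> * (L1 * norm z * norm p)"
  proof -
    have "\<bar>\<nu> * (D1 f y p - D1 f x p)\<bar> \<le> \<bar>\<nu>\<bar> * (L1 * norm z * norm p)"
      unfolding abs_mult z_def by (intro mult_left_mono D1_f_diff_bound Rn) simp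
    then show ?thesis
      using D1_fh_linearization[OF Rn(1,2), of p] by (simp add: z_def abs_le_iff)
  qed
  also have "\<dots> \<le> Lh2 * (\<bar>\<nu>\<bar> * a)\<^sup>2 * norm p + \<bar>\<nu>\<bar> * (L1 * (\<bar>\<nu>\<bar> * a) * norm p)"
    using constants_nonneg z
    by (intro add_mono mult_right_mono mult_left_mono power_mono) auto
  also have "\<dots> = c * norm p"
    by (simp add: c_def power_mult_distrib power2_eq_square algebra_simps flip: abs_mult)
  finally have "norm p \<le> c / \<mu>"
    using constants_nonneg a by (intro norm_le_of_hess_le[OF Rn(1,4)]) (auto simp: c_def)
  then show ?thesis by (simp add: p_def z_def x_def y_def c_def a_def)
qed

section \<open>Gradient of the meta-objective and the forward estimator\<close>

text \<open>A quadratic remainder for the composite is estimated directly, which avoids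
  differentiating \<open>sol 0\<close> in \<theta>.\<close>

lemma GDERIV_meta_obj:
  assumes \<theta>: "\<theta> \<in> Rn d"
  shows "GDERIV (meta_obj d lam f fh) \<theta> :> lam *\<^sub>R sens \<theta>"
  unfolding gderiv_def
proof (rule has_derivative_quadratic_remainder)
  let ?F = "meta_obj d lam f fh" and ?w = "sens \<theta>"
  \<comment> \<open>Its dependence on \<theta> through \<open>?w\<close> is harmless:
    \<open>K\<close> serves differentiability at this one point.\<close>
  define K where "K = (L1 + Lh2 * norm ?w) * (lam / \<mu>)\<^sup>2"
  show "bounded_linear (\<lambda>h. inner h (lam *\<^sub>R ?w))" by (rule bounded_linear_inner_left)
  fix h
  \<comment> \<open>The increment \<open>h\<close> may leave \<open>Rn d\<close>. The meta-objective
    sees only its projection \<open>k\<close>, and so does the inner product with \<open>?w\<close>,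
    which lies in \<open>Rn d\<close>.\<close>
  define k where "k = trunc d h"
  define x y z where "x = sol 0 \<theta>" and "y = sol 0 (\<theta> + k)" and "z = y - x"
  have k: "k \<in> Rn d" "\<theta> + k \<in> Rn d" using \<theta> by (auto simp: k_def trunc_Rn Rn_intros)
  have Rn: "x \<in> Rn d" "y \<in> Rn d" "z \<in> Rn d" "?w \<in> Rn d"
    using \<theta> k by (auto simp: x_def y_def z_def sol_Rn sens_Rn Rn_intros)
  have "?F (\<theta> + h) = ?F (trunc d (\<theta> + h))"
    using fun_on_Rn_meta_obj by (simp add: fun_on_Rn_def)
  also have "trunc d (\<theta> + h) = \<theta> + k"
    using trunc_id[OF \<theta>] bounded_linear_trunc[of d] by (simp add: k_def linear_simps)
  finally have F: "?F (\<theta> + h) = f y" "?F \<theta> = f x" by (simp_all add: meta_obj_def x_def y_def)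
  have ip: "inner h ?w = inner k ?w"
    using trunc_orthogonal[OF Rn(4), of h]
    by (simp add: k_def inner_diff_right inner_commute[of _ ?w])
  have z: "norm z \<le> lam / \<mu> * norm h"
  proof -
    have "norm z \<le> lam / \<mu> * norm k"
      using sol_lipschitz[OF \<theta> k(2), of 0] by (simp add: x_def y_def z_def)
    also have "\<dots> \<le> lam / \<mu> * norm h"
      using lam mu norm_trunc_le by (intro mult_left_mono) (auto simp: k_def)
    finally show ?thesis .
  qed
  \<comment> \<open>Duality: symmetry moves the Hessian from \<open>?w\<close> to \<open>z\<close>,
    and the difference of the stationarity conditions tested with \<open>?w\<close> replaces it by
    \<open>lam * inner k ?w\<close> up to a Taylor remainder.\<close>
  have "D1 f x z = hess x z ?w"
    using hess_sens[OF \<theta> Rn(3)] hess_symmetric[OF Rn(1,4,3)] by (simp add: x_def)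
  also have "\<dots> = lam * inner k ?w - (D1 fh y ?w - D1 fh x ?w - D2 fh x (y - x) ?w)"
    using sol_stationary[OF \<theta> Rn(4), of 0] sol_stationary[OF k(2) Rn(4), of 0]
    by (simp add: x_def[symmetric] y_def[symmetric] hess_def)
      (simp add: z_def inner_diff_left inner_add_left algebra_simps)
  finally have "\<bar>f y - f x - lam * inner k ?w\<bar>
      \<le> L1 * (norm z)\<^sup>2 + Lh2 * (norm z)\<^sup>2 * norm ?w"
    using D1_fh_linearization[OF Rn(1,2), of ?w] f_linearization[OF Rn(1,2)]
    by (simp add: z_def abs_le_iff)
  also have "\<dots> = (L1 + Lh2 * norm ?w) * (norm z)\<^sup>2" by (simp add: algebra_simps)
  also have "\<dots> \<le> (L1 + Lh2 * norm ?w) * (lam / \<mu> * norm h)\<^sup>2"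
    using constants_nonneg z by (intro mult_left_mono power_mono) auto
  finally show "norm (?F (\<theta> + h) - ?F \<theta> - inner h (lam *\<^sub>R ?w)) \<le> K * (norm h)\<^sup>2"
    by (simp add: F ip K_def power_mult_distrib power_divide mult_ac)
qed

lemma gradient_meta_obj:
  assumes "\<theta> \<in> Rn d"
  shows "meta_obj d lam f fh differentiable (at \<theta>)"
    and "gradient (meta_obj d lam f fh) \<theta> = lam *\<^sub>R sens \<theta>"
  using GDERIV_meta_obj[OF assms] 
  by (auto simp: gradient_eqI gderiv_def differentiable_def)

text \<open>The expansion error is of order \<nu>, the two solver errors of order \<delta>/\<nu>;
  \<nu> of order \<delta>^(1/2) balances them.\<close>

lemma forward_error:
  assumes \<theta>: "\<theta> \<in> Rn d" and \<nu>: "\<nu> > 0"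
    and approx: "approx_sol d lam f fh \<delta> \<nu> \<theta> (\<psi> \<nu> \<theta>)" "approx_sol d lam f fh \<delta> 0 \<theta> (\<psi> 0 \<theta>)"
  shows "norm (lam *\<^sub>R sens \<theta> - g_For lam \<psi> \<nu> \<theta>)
    \<le> lam * ((Lh2 * (L0 / \<mu>)\<^sup>2 + L1 * (L0 / \<mu>)) / \<mu> * \<nu> + 2 * (\<delta> / \<nu>))"
proof -
  define E where "E = (Lh2 * (L0 / \<mu>)\<^sup>2 + L1 * (L0 / \<mu>)) / \<mu>"
  define e1 e0 p where "e1 = \<psi> \<nu> \<theta> - sol \<nu> \<theta>" and "e0 = \<psi> 0 \<theta> - sol 0 \<theta>"
    and "p = sol \<nu> \<theta> - sol 0 \<theta> + \<nu> *\<^sub>R sens \<theta>"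
  have "\<psi> \<nu> \<theta> - \<psi> 0 \<theta> = p + e1 - e0 - \<nu> *\<^sub>R sens \<theta>"
    by (simp add: e1_def e0_def p_def)
  \<comment> \<open>The term \<open>\<nu> *\<^sub>R sens \<theta>\<close> is split off so that,
    scaled by \<open>lam / \<nu>\<close>, it cancels the exact gradient.\<close>
  then have "lam *\<^sub>R sens \<theta> - g_For lam \<psi> \<nu> \<theta>
      = lam *\<^sub>R sens \<theta> + (lam / \<nu>) *\<^sub>R (p + e1 - e0 - \<nu> *\<^sub>R sens \<theta>)"
    by (simp only: g_For_def) (simp add: divide_inverse)
  then have eq: "lam *\<^sub>R sens \<theta> - g_For lam \<psi> \<nu> \<theta> = (lam / \<nu>) *\<^sub>R (p + e1 - e0)"
    using \<nu> by (simp add: scaleR_diff_right[of _ "p + e1 - e0"])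
  have "norm p \<le> E * \<nu>\<^sup>2" unfolding p_def E_def by (rule sol_expansion[OF \<theta>])
  moreover have "norm e1 \<le> \<delta>" "norm e0 \<le> \<delta>"
    using approx by (simp_all add: approx_sol_def e1_def e0_def)
  ultimately have "norm (p + e1 - e0) \<le> E * \<nu>\<^sup>2 + \<delta> + \<delta>"
    using norm_triangle_ineq4[of "p + e1" e0] norm_triangle_ineq[of p e1] by linarith
  then have "norm (lam *\<^sub>R sens \<theta> - g_For lam \<psi> \<nu> \<theta>)
      \<le> lam / \<nu> * (E * \<nu>\<^sup>2 + \<delta> + \<delta>)"
    unfolding eq norm_scaleR using lam \<nu> by (intro mult_mono) auto
  also have "\<dots> = lam * (E * \<nu> + 2 * (\<delta> / \<nu>))"
    using \<nu> by (simp add: field_simps power2_eq_square)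
  finally show ?thesis by (simp add: E_def)
qed

end

section \<open>The symmetric estimator under higher smoothness\<close>

locale smooth_inner_problem = inner_problem +
  fixes L2 Lh3 :: real
  assumes train_C4: "train_C4 d Lh3 fh" and test_C3: "test_C3 d L2 f"
begin

text \<open>Expanding around the midpoint of \<open>sol \<nu> \<theta>\<close> and \<open>sol (- \<nu>) \<theta>\<close> rather than around \<open>sol 0 \<theta>\<close>
  makes the second-order terms cancel, so no third-derivative term has to be estimated.\<close>

lemma sol_symmetric_expansion:
  assumes \<theta>: "\<theta> \<in> Rn d"
  defines "a \<equiv> L0 / \<mu>"
  defines "E \<equiv> (Lh2 * a\<^sup>2 + L1 * a) / \<mu>"
  assumes \<nu>: "\<nu> > 0"
  shows "norm ((sol \<nu> \<theta> - sol (- \<nu>) \<theta>) /\<^sub>R 2 + \<nu> *\<^sub>R sens \<theta>)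
    \<le> (Lh2 * E * a + Lh3 * a ^ 3 + L2 * a\<^sup>2 + L1 * E) / \<mu> * \<nu> ^ 3"
proof -
  define x y y' m k p where "x = sol 0 \<theta>" and "y = sol \<nu> \<theta>" and "y' = sol (- \<nu>) \<theta>"
    and "m = (y + y') /\<^sub>R 2" and "k = (y - y') /\<^sub>R 2" and "p = k + \<nu> *\<^sub>R sens \<theta>"
  define c where "c = (Lh2 * E * a + Lh3 * a ^ 3 + L2 * a\<^sup>2 + L1 * E) * \<nu> ^ 3"
  have nonneg: "0 \<le> a" "0 \<le> E" "0 \<le> L2" "0 \<le> Lh3"
    using constants_nonneg mu train_C4 test_C3
    by (auto simp: a_def E_def train_C4_def test_C3_def dest: lipschitz_on_nonneg)
  have Rn: "x \<in> Rn d" "y \<in> Rn d" "y' \<in> Rn d" "m \<in> Rn d" "k \<in> Rn d" "p \<in> Rn d"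
    using \<theta> by (auto simp: x_def y_def y'_def m_def k_def p_def sol_Rn sens_Rn Rn_intros)
  have half: "v /\<^sub>R 2 + v /\<^sub>R 2 = v" for v :: fseq
    by (simp add: scaleR_add_left[symmetric])
  have mk: "m + k = y" "m - k = y'"
    using half[of y] half[of y'] by (simp_all add: m_def k_def algebra_simps)
  have k: "norm k \<le> \<nu> * a"
  proof -
    have "norm (y - x) \<le> \<nu> * a" "norm (y' - x) \<le> \<nu> * a"
      using sol_lipschitz[OF \<theta> \<theta>, of \<nu>] sol_lipschitz[OF \<theta> \<theta>, of "- \<nu>"] \<nu>
      by (auto simp: x_def y_def y'_def a_def)
    then have "norm (y - y') \<le> 2 * (\<nu> * a)"
      using norm_triangle_ineq4[of "y - x" "y' - x"] by simp
    then show ?thesis by (simp add: k_def)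
  qed
  \<comment> \<open>The first-order displacements at \<nu> and -\<nu> are opposite, so the midpoint
    stays within O(\<nu>^2) of \<open>x\<close>, whereas \<open>y\<close> and \<open>y'\<close> are
    only within O(\<nu>).\<close>
  have m: "norm (m - x) \<le> E * \<nu>\<^sup>2"
  proof -
    have "m - x = ((y - x + \<nu> *\<^sub>R sens \<theta>) + (y' - x + (- \<nu>) *\<^sub>R sens \<theta>)) /\<^sub>R 2"
      using half[of x] by (simp add: m_def algebra_simps)
    moreover have "norm ((y - x + \<nu> *\<^sub>R sens \<theta>) + (y' - x + (- \<nu>) *\<^sub>R sens \<theta>))
        \<le> E * \<nu>\<^sup>2 + E * \<nu>\<^sup>2"
      using sol_expansion[OF \<theta>, of \<nu>] sol_expansion[OF \<theta>, of "- \<nu>"]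
      by (intro norm_triangle_mono) (auto simp: x_def y_def y'_def a_def E_def)
    ultimately show ?thesis by simp
  qed
  \<comment> \<open>\<open>A1\<close> and \<open>A4\<close> are the cost of moving the base point
    from \<open>m\<close> to \<open>x\<close>; \<open>A2\<close> and \<open>A3\<close> are the
    symmetric remainders at \<open>m\<close>. \<open>A1\<close> and \<open>A2\<close> are
    O(\<nu>^3), \<open>A3\<close> and \<open>A4\<close> are O(\<nu>^2) and carry a further factor
    \<nu>.\<close>
  define A1 A2 A3 A4 where "A1 = (D2 fh m - D2 fh x) k"
    and "A2 = D1 fh (m + k) - D1 fh (m - k) - 2 *\<^sub>R D2 fh m k"
    and "A3 = D1 f (m + k) + D1 f (m - k) - 2 *\<^sub>R D1 f m"
    and "A4 = D1 f m - D1 f x"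
  have "2 * hess x p p = 2 * hess x k p + 2 * \<nu> * hess x (sens \<theta>) p"
    by (simp add: hess_def p_def blinfun.add_left blinfun.add_right blinfun.scaleR_left
        blinfun.scaleR_right inner_add_left algebra_simps)
  also have "hess x (sens \<theta>) p = D1 f x p"
    using hess_sens[OF \<theta> Rn(6)] by (simp add: x_def)
  \<comment> \<open>Subtracting the stationarity conditions at \<nu> and -\<nu> eliminates \<theta>.
    As \<nu> changes sign, \<open>D1 f\<close> appears as a sum and \<open>D1 fh\<close> as a
    difference, which are exactly the combinations with small symmetric remainders. Doubling absorbs
    \<open>y - y'\<close> being twice \<open>k\<close>.\<close>
  also have "2 * hess x k p + 2 * \<nu> * D1 f x p
      = - ((2 *\<^sub>R A1 + A2 + \<nu> *\<^sub>R A3 + (2 * \<nu>) *\<^sub>R A4) p)"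
  proof -
    have "2 * inner k p = inner y p - inner y' p" by (simp add: k_def inner_diff_left)
    then have "2 * hess x k p = 2 * D2 fh x k p + lam * (inner y p - inner y' p)"
      unfolding hess_def by (metis (no_types) distrib_left mult.left_commute)
    then show ?thesis
      using sol_stationary[OF \<theta> Rn(6), of \<nu>] sol_stationary[OF \<theta> Rn(6), of "- \<nu>"]
      unfolding mk A1_def A2_def A3_def A4_def
      by (simp add: y_def[symmetric] y'_def[symmetric] blinfun.add_left blinfun.diff_left
          blinfun.scaleR_left inner_diff_left algebra_simps)
  qed
  also have "\<dots> \<le> norm (2 *\<^sub>R A1 + A2 + \<nu> *\<^sub>R A3 + (2 * \<nu>) *\<^sub>R A4) * norm p"
    using norm_blinfun[of "2 *\<^sub>R A1 + A2 + \<nu> *\<^sub>R A3 + (2 * \<nu>) *\<^sub>R A4" p] by (simp add: abs_le_iff)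
  also have "\<dots> \<le> (2 * c) * norm p"
  proof (rule mult_right_mono)
    have "norm A1 \<le> norm (D2 fh m - D2 fh x) * norm k" unfolding A1_def by (rule norm_blinfun)
    also have "\<dots> \<le> Lh2 * norm (m - x) * norm k"
      using lipschitz_onD[OF lipschitz_D2_fh Rn(4,1)] by (intro mult_right_mono) (auto simp: dist_norm)
    also have "\<dots> \<le> Lh2 * (E * \<nu>\<^sup>2) * (\<nu> * a)"
      using k m nonneg constants_nonneg by (intro mult_mono) auto
    finally have A1: "norm A1 \<le> Lh2 * E * a * \<nu> ^ 3"
      by (simp add: power2_eq_square power3_eq_cube mult_ac)
    have "norm A2 \<le> 2 * Lh3 * norm k ^ 3"
      unfolding A2_def
    proof (rule central_difference_bound[OF subspace_Rn Rn(4,5) D2_fh])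
      show "(D2 fh has_derivative blinfun_apply (D3 fh z)) (at z)" if "z \<in> Rn d" for z
        using train_C4 that by (auto simp: train_C4_def diff_on_Rn_def intro: has_derivative_fderiv)
      show "Lh3-lipschitz_on (Rn d) (D3 fh)" using train_C4 by (simp add: train_C4_def)
    qed
    also have "\<dots> \<le> 2 * Lh3 * (\<nu> * a) ^ 3"
      using k nonneg by (intro mult_left_mono power_mono) auto
    finally have A2: "norm A2 \<le> 2 * (Lh3 * a ^ 3 * \<nu> ^ 3)"
      by (simp add: power_mult_distrib mult_ac)
    have "norm A3 \<le> 2 * L2 * (norm k)\<^sup>2"
      unfolding A3_def
    proof (rule second_difference_bound[OF convex_Rn Rn(4)])
      show "(D1 f has_derivative blinfun_apply (D2 f z)) (at z)" if "z \<in> Rn d" for z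
        using test_C3 that by (auto simp: test_C3_def diff_on_Rn_def intro: has_derivative_fderiv)
      show "L2-lipschitz_on (Rn d) (D2 f)" using test_C3 by (simp add: test_C3_def)
    qed (simp_all add: mk Rn)
    also have "\<dots> \<le> 2 * L2 * (\<nu> * a)\<^sup>2"
      using k nonneg by (intro mult_left_mono power_mono) auto
    finally have "\<nu> * norm A3 \<le> \<nu> * (2 * L2 * (\<nu> * a)\<^sup>2)" using \<nu> by (intro mult_left_mono) auto
    then have A3: "\<nu> * norm A3 \<le> 2 * (L2 * a\<^sup>2 * \<nu> ^ 3)"
      by (simp add: power2_eq_square power3_eq_cube mult_ac)
    have "norm A4 \<le> L1 * norm (m - x)"
      unfolding A4_def using lipschitz_onD[OF lipschitz_D1_f Rn(4,1)] by (simp add: dist_norm)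
    also have "\<dots> \<le> L1 * (E * \<nu>\<^sup>2)" using m constants_nonneg by (intro mult_left_mono)
    finally have "\<nu> * norm A4 \<le> \<nu> * (L1 * (E * \<nu>\<^sup>2))" using \<nu> by (intro mult_left_mono) auto
    then have A4: "\<nu> * norm A4 \<le> L1 * E * \<nu> ^ 3"
      by (simp add: power2_eq_square power3_eq_cube mult_ac)
    have "norm (2 *\<^sub>R A1 + A2 + \<nu> *\<^sub>R A3 + (2 * \<nu>) *\<^sub>R A4)
        \<le> 2 * norm A1 + norm A2 + \<nu> * norm A3 + 2 * (\<nu> * norm A4)"
      using \<nu> by (intro norm_triangle_mono) auto
    also have "\<dots> \<le> 2 * c" using A1 A2 A3 A4 by (simp add: c_def algebra_simps)
    finally show "norm (2 *\<^sub>R A1 + A2 + \<nu> *\<^sub>R A3 + (2 * \<nu>) *\<^sub>R A4) \<le> 2 * c" .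
  qed simp
  finally have "norm p \<le> c / \<mu>"
    using constants_nonneg nonneg \<nu> by (intro norm_le_of_hess_le[OF Rn(1,6)]) (auto simp: c_def)
  then show ?thesis by (simp add: p_def k_def y_def y'_def c_def)
qed

text \<open>The two solver errors are averaged, hence a single \<delta>/\<nu>. Balancing it against
  \<nu>^2 gives \<nu> of order \<delta>^(1/3) and the rate \<delta>^(2/3).\<close>

lemma symmetric_error:
  assumes \<theta>: "\<theta> \<in> Rn d" and \<nu>: "\<nu> > 0"
    and approx: "approx_sol d lam f fh \<delta> \<nu> \<theta> (\<psi> \<nu> \<theta>)"
      "approx_sol d lam f fh \<delta> (- \<nu>) \<theta> (\<psi> (- \<nu>) \<theta>)"
  defines "a \<equiv> L0 / \<mu>"
  defines "E \<equiv> (Lh2 * a\<^sup>2 + L1 * a) / \<mu>"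
  shows "norm (lam *\<^sub>R sens \<theta> - g_Sym lam \<psi> \<nu> \<theta>)
    \<le> lam * ((Lh2 * E * a + Lh3 * a ^ 3 + L2 * a\<^sup>2 + L1 * E) / \<mu> * \<nu>\<^sup>2 + \<delta> / \<nu>)"
proof -
  define C where "C = (Lh2 * E * a + Lh3 * a ^ 3 + L2 * a\<^sup>2 + L1 * E) / \<mu>"
  define e1 e0 p where "e1 = \<psi> \<nu> \<theta> - sol \<nu> \<theta>" and "e0 = \<psi> (- \<nu>) \<theta> - sol (- \<nu>) \<theta>"
    and "p = (sol \<nu> \<theta> - sol (- \<nu>) \<theta>) /\<^sub>R 2 + \<nu> *\<^sub>R sens \<theta>"
  have "\<psi> \<nu> \<theta> - \<psi> (- \<nu>) \<theta> = (sol \<nu> \<theta> - sol (- \<nu>) \<theta>) + (e1 - e0)"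
    by (simp add: e1_def e0_def)
  \<comment> \<open>Used with \<open>w\<close> equal to
    \<open>\<nu> *\<^sub>R sens \<theta>\<close>, to insert the expansion error
    \<open>p\<close>.\<close>
  moreover have "u + v = u + w + v - w" for u v w :: fseq by simp
  ultimately have q: "(\<psi> \<nu> \<theta> - \<psi> (- \<nu>) \<theta>) /\<^sub>R 2 = p + (e1 - e0) /\<^sub>R 2 - \<nu> *\<^sub>R sens \<theta>"
    unfolding p_def by (metis scaleR_add_right)
  have "- lam * inverse (2 * \<nu>) = - (lam / \<nu>) * inverse 2" by (simp add: divide_simps)
  then have "g_Sym lam \<psi> \<nu> \<theta> = - (lam / \<nu>) *\<^sub>R ((\<psi> \<nu> \<theta> - \<psi> (- \<nu>) \<theta>) /\<^sub>R 2)"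
    by (simp only: g_Sym_def scaleR_scaleR)
  then have "lam *\<^sub>R sens \<theta> - g_Sym lam \<psi> \<nu> \<theta>
      = lam *\<^sub>R sens \<theta> + (lam / \<nu>) *\<^sub>R (p + (e1 - e0) /\<^sub>R 2 - \<nu> *\<^sub>R sens \<theta>)"
    by (simp only: q) simp
  moreover have "lam *\<^sub>R u + (lam / \<nu>) *\<^sub>R (v - \<nu> *\<^sub>R u) = (lam / \<nu>) *\<^sub>R v" for u v :: fseq
    using \<nu> by (simp add: scaleR_diff_right)
  ultimately have eq: "lam *\<^sub>R sens \<theta> - g_Sym lam \<psi> \<nu> \<theta> = (lam / \<nu>) *\<^sub>R (p + (e1 - e0) /\<^sub>R 2)"
    by (rule trans)
  have "norm p \<le> C * \<nu> ^ 3"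
    unfolding p_def C_def E_def a_def by (rule sol_symmetric_expansion[OF \<theta> \<nu>])
  moreover have "norm e1 \<le> \<delta>" "norm e0 \<le> \<delta>"
    using approx by (simp_all add: approx_sol_def e1_def e0_def)
  then have "norm ((e1 - e0) /\<^sub>R 2) \<le> \<delta>"
    using norm_triangle_ineq4[of e1 e0] by simp
  ultimately have "norm (p + (e1 - e0) /\<^sub>R 2) \<le> C * \<nu> ^ 3 + \<delta>"
    by (rule norm_triangle_mono)
  then have "norm (lam *\<^sub>R sens \<theta> - g_Sym lam \<psi> \<nu> \<theta>) \<le> lam / \<nu> * (C * \<nu> ^ 3 + \<delta>)"
    unfolding eq norm_scaleR using lam \<nu> by (intro mult_mono) auto
  also have "\<dots> = lam * (C * \<nu>\<^sup>2 + \<delta> / \<nu>)"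
    using \<nu> by (simp add: field_simps power2_eq_square power3_eq_cube)
  finally show ?thesis by (simp add: C_def)
qed

end

section \<open>Choice of \<nu> and uniform constants\<close>

theorem corollary1:
  fixes c1 c2 L0 L1 L2 Lh1 Lh2 Lh3 lam \<mu> :: real
  assumes "0 < c1" "c1 \<le> c2" "0 < lam" "0 < \<mu>"
  shows
   "(\<exists>C \<delta>0. 0 < \<delta>0 \<and>
      (\<forall>(d::nat) (M::nat) (f :: nat \<Rightarrow> fseq \<Rightarrow> real) (fh :: nat \<Rightarrow> fseq \<Rightarrow> real).
        (\<forall>i\<in>{1..M}. fun_on_Rn d (f i) \<and> fun_on_Rn d (fh i) \<and>
            train_regular d Lh1 Lh2 (fh i) \<and> test_regular d L0 L1 (f i) \<and>
            train_strongly_convex d lam \<mu> (fh i)) \<longrightarrow>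
        (\<forall>\<delta> \<nu> (\<psi> :: nat \<Rightarrow> real \<Rightarrow> fseq \<Rightarrow> fseq).
          0 < \<delta> \<and> \<delta> < \<delta>0 \<and>
          c1 * \<delta> powr (1/2) \<le> \<nu> \<and> \<nu> \<le> c2 * \<delta> powr (1/2) \<and>
          (\<forall>i\<in>{1..M}. \<forall>\<theta>\<in>Rn d. \<forall>\<nu>'\<in>{\<nu>, 0}.
              approx_sol d lam (f i) (fh i) \<delta> \<nu>' \<theta> (\<psi> i \<nu>' \<theta>)) \<longrightarrow>
          (\<forall>i\<in>{1..M}. \<forall>\<theta>\<in>Rn d.
             meta_obj d lam (f i) (fh i) differentiable (at \<theta>) \<and>
             norm (gradient (meta_obj d lam (f i) (fh i)) \<theta> - g_For lam (\<psi> i) \<nu> \<theta>)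
               \<le> C * (lam * \<delta> powr (1/2))))))
    \<and>
    (\<exists>C \<delta>0. 0 < \<delta>0 \<and>
      (\<forall>(d::nat) (M::nat) (f :: nat \<Rightarrow> fseq \<Rightarrow> real) (fh :: nat \<Rightarrow> fseq \<Rightarrow> real).
        (\<forall>i\<in>{1..M}. fun_on_Rn d (f i) \<and> fun_on_Rn d (fh i) \<and>
            train_regular d Lh1 Lh2 (fh i) \<and> test_regular d L0 L1 (f i) \<and>
            train_strongly_convex d lam \<mu> (fh i) \<and>
            train_C4 d Lh3 (fh i) \<and> test_C3 d L2 (f i)) \<longrightarrow>
        (\<forall>\<delta> \<nu> (\<psi> :: nat \<Rightarrow> real \<Rightarrow> fseq \<Rightarrow> fseq).
          0 < \<delta> \<and> \<delta> < \<delta>0 \<and>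
          c1 * \<delta> powr (1/3) \<le> \<nu> \<and> \<nu> \<le> c2 * \<delta> powr (1/3) \<and>
          (\<forall>i\<in>{1..M}. \<forall>\<theta>\<in>Rn d. \<forall>\<nu>'\<in>{\<nu>, - \<nu>}.
              approx_sol d lam (f i) (fh i) \<delta> \<nu>' \<theta> (\<psi> i \<nu>' \<theta>)) \<longrightarrow>
          (\<forall>i\<in>{1..M}. \<forall>\<theta>\<in>Rn d.
             meta_obj d lam (f i) (fh i) differentiable (at \<theta>) \<and>
             norm (gradient (meta_obj d lam (f i) (fh i)) \<theta> - g_Sym lam (\<psi> i) \<nu> \<theta>)
               \<le> C * (lam * \<delta> powr (2/3))))))"
proof (intro conjI)
  \<comment> \<open>\<open>a\<close> is the rate from \<open>sol_lipschitz\<close>, \<open>E\<close>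
    the coefficient in \<open>sol_expansion\<close>, \<open>G\<close> the one in
    \<open>sol_symmetric_expansion\<close>. They are fixed before any task or dimension is
    introduced.\<close>
  define a where "a = L0 / \<mu>"
  define E where "E = (Lh2 * a\<^sup>2 + L1 * a) / \<mu>"
  define G where "G = (Lh2 * E * a + Lh3 * a ^ 3 + L2 * a\<^sup>2 + L1 * E) / \<mu>"
  show "(\<exists>C \<delta>0. 0 < \<delta>0 \<and>
      (\<forall>(d::nat) (M::nat) (f :: nat \<Rightarrow> fseq \<Rightarrow> real) (fh :: nat \<Rightarrow> fseq \<Rightarrow> real).
        (\<forall>i\<in>{1..M}. fun_on_Rn d (f i) \<and> fun_on_Rn d (fh i) \<and>
            train_regular d Lh1 Lh2 (fh i) \<and> test_regular d L0 L1 (f i) \<and>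
            train_strongly_convex d lam \<mu> (fh i)) \<longrightarrow>
        (\<forall>\<delta> \<nu> (\<psi> :: nat \<Rightarrow> real \<Rightarrow> fseq \<Rightarrow> fseq).
          0 < \<delta> \<and> \<delta> < \<delta>0 \<and>
          c1 * \<delta> powr (1/2) \<le> \<nu> \<and> \<nu> \<le> c2 * \<delta> powr (1/2) \<and>
          (\<forall>i\<in>{1..M}. \<forall>\<theta>\<in>Rn d. \<forall>\<nu>'\<in>{\<nu>, 0}.
              approx_sol d lam (f i) (fh i) \<delta> \<nu>' \<theta> (\<psi> i \<nu>' \<theta>)) \<longrightarrow>
          (\<forall>i\<in>{1..M}. \<forall>\<theta>\<in>Rn d.
             meta_obj d lam (f i) (fh i) differentiable (at \<theta>) \<and>
             norm (gradient (meta_obj d lam (f i) (fh i)) \<theta> - g_For lam (\<psi> i) \<nu> \<theta>)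
               \<le> C * (lam * \<delta> powr (1/2))))))"
  \<comment> \<open>The upper bound on \<nu> controls the expansion error and gives
    \<open>E * c2\<close>; the lower bound controls \<delta>/\<nu> and gives \<open>2 / c1\<close>.
    The estimates hold for every positive \<nu>, so the threshold 1 is arbitrary.\<close>
  proof (rule exI[of _ "E * c2 + 2 / c1"], rule exI[of _ 1], intro conjI allI impI ballI; (elim conjE)?)
    fix d M :: nat and f fh :: "nat \<Rightarrow> fseq \<Rightarrow> real" and \<delta> \<nu> :: real
      and \<psi> :: "nat \<Rightarrow> real \<Rightarrow> fseq \<Rightarrow> fseq" and i :: nat and \<theta>
    assume tasks: "\<forall>i\<in>{1..M}. fun_on_Rn d (f i) \<and> fun_on_Rn d (fh i) \<and>
        train_regular d Lh1 Lh2 (fh i) \<and> test_regular d L0 L1 (f i) \<and>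
        train_strongly_convex d lam \<mu> (fh i)"
      and \<delta>: "0 < \<delta>" and \<nu>: "c1 * \<delta> powr (1/2) \<le> \<nu>" "\<nu> \<le> c2 * \<delta> powr (1/2)"
      and approx: "\<forall>i\<in>{1..M}. \<forall>\<theta>\<in>Rn d. \<forall>\<nu>'\<in>{\<nu>, 0}.
        approx_sol d lam (f i) (fh i) \<delta> \<nu>' \<theta> (\<psi> i \<nu>' \<theta>)"
      and i: "i \<in> {1..M}" and \<theta>: "\<theta> \<in> Rn d"
    interpret inner_problem d lam \<mu> L0 L1 Lh1 Lh2 "f i" "fh i"
      using assms tasks i by unfold_locales auto
    show "meta_obj d lam (f i) (fh i) differentiable (at \<theta>)" by (rule gradient_meta_obj[OF \<theta>])
    define s where "s = \<delta> powr (1/2)"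
    have s: "s > 0" "s * s = \<delta>" using \<delta> by (simp_all add: s_def flip: powr_add)
    have \<nu>s: "c1 * s \<le> \<nu>" "\<nu> \<le> c2 * s" "0 < \<nu>"
      using \<nu> less_le_trans[OF mult_pos_pos[OF assms(1) s(1)]] by (auto simp: s_def)
    have "\<delta> / \<nu> \<le> \<delta> / (c1 * s)"
      using \<delta> s assms \<nu>s by (intro divide_left_mono) auto
    also have "\<dots> = s / c1" using s assms by (simp add: field_simps)
    finally have "\<delta> / \<nu> \<le> s / c1" .
    \<comment> \<open>The sign of \<open>E\<close> is known only now: nonnegativity of the Lipschitz
      constants is extracted from the task \<open>i\<close>.\<close>
    moreover have "E * \<nu> \<le> E * (c2 * s)"
      using \<nu>s constants_nonneg mu by (intro mult_left_mono) (auto simp: E_def a_def)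
    moreover have "(E * c2 + 2 / c1) * s = E * (c2 * s) + 2 * (s / c1)"
      by (simp add: algebra_simps)
    ultimately have le: "E * \<nu> + 2 * (\<delta> / \<nu>) \<le> (E * c2 + 2 / c1) * s"
      by linarith
    have "norm (lam *\<^sub>R sens \<theta> - g_For lam (\<psi> i) \<nu> \<theta>) \<le> lam * (E * \<nu> + 2 * (\<delta> / \<nu>))"
      using forward_error[OF \<theta> \<nu>s(3)] approx i \<theta> by (simp add: E_def a_def)
    also have "\<dots> \<le> lam * ((E * c2 + 2 / c1) * s)"
      using le lam by (intro mult_left_mono) auto
    finally show "norm (gradient (meta_obj d lam (f i) (fh i)) \<theta> - g_For lam (\<psi> i) \<nu> \<theta>)
        \<le> (E * c2 + 2 / c1) * (lam * \<delta> powr (1/2))"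
      by (simp add: gradient_meta_obj[OF \<theta>] s_def mult_ac)
  qed simp
  show "(\<exists>C \<delta>0. 0 < \<delta>0 \<and>
      (\<forall>(d::nat) (M::nat) (f :: nat \<Rightarrow> fseq \<Rightarrow> real) (fh :: nat \<Rightarrow> fseq \<Rightarrow> real).
        (\<forall>i\<in>{1..M}. fun_on_Rn d (f i) \<and> fun_on_Rn d (fh i) \<and>
            train_regular d Lh1 Lh2 (fh i) \<and> test_regular d L0 L1 (f i) \<and>
            train_strongly_convex d lam \<mu> (fh i) \<and>
            train_C4 d Lh3 (fh i) \<and> test_C3 d L2 (f i)) \<longrightarrow>
        (\<forall>\<delta> \<nu> (\<psi> :: nat \<Rightarrow> real \<Rightarrow> fseq \<Rightarrow> fseq).
          0 < \<delta> \<and> \<delta> < \<delta>0 \<and>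
          c1 * \<delta> powr (1/3) \<le> \<nu> \<and> \<nu> \<le> c2 * \<delta> powr (1/3) \<and>
          (\<forall>i\<in>{1..M}. \<forall>\<theta>\<in>Rn d. \<forall>\<nu>'\<in>{\<nu>, - \<nu>}.
              approx_sol d lam (f i) (fh i) \<delta> \<nu>' \<theta> (\<psi> i \<nu>' \<theta>)) \<longrightarrow>
          (\<forall>i\<in>{1..M}. \<forall>\<theta>\<in>Rn d.
             meta_obj d lam (f i) (fh i) differentiable (at \<theta>) \<and>
             norm (gradient (meta_obj d lam (f i) (fh i)) \<theta> - g_Sym lam (\<psi> i) \<nu> \<theta>)
               \<le> C * (lam * \<delta> powr (2/3))))))"
  \<comment> \<open>As in the forward case, with the expansion error now quadratic in \<nu>, hence
    the square of \<open>c2\<close>, and a single averaged solver error.\<close>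
  proof (rule exI[of _ "G * c2\<^sup>2 + 1 / c1"], rule exI[of _ 1], intro conjI allI impI ballI; (elim conjE)?)
    fix d M :: nat and f fh :: "nat \<Rightarrow> fseq \<Rightarrow> real" and \<delta> \<nu> :: real
      and \<psi> :: "nat \<Rightarrow> real \<Rightarrow> fseq \<Rightarrow> fseq" and i :: nat and \<theta>
    assume tasks: "\<forall>i\<in>{1..M}. fun_on_Rn d (f i) \<and> fun_on_Rn d (fh i) \<and>
        train_regular d Lh1 Lh2 (fh i) \<and> test_regular d L0 L1 (f i) \<and>
        train_strongly_convex d lam \<mu> (fh i) \<and> train_C4 d Lh3 (fh i) \<and> test_C3 d L2 (f i)"
      and \<delta>: "0 < \<delta>" and \<nu>: "c1 * \<delta> powr (1/3) \<le> \<nu>" "\<nu> \<le> c2 * \<delta> powr (1/3)"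
      and approx: "\<forall>i\<in>{1..M}. \<forall>\<theta>\<in>Rn d. \<forall>\<nu>'\<in>{\<nu>, - \<nu>}.
        approx_sol d lam (f i) (fh i) \<delta> \<nu>' \<theta> (\<psi> i \<nu>' \<theta>)"
      and i: "i \<in> {1..M}" and \<theta>: "\<theta> \<in> Rn d"
    interpret smooth_inner_problem d lam \<mu> L0 L1 Lh1 Lh2 "f i" "fh i" L2 Lh3
      using assms tasks i by unfold_locales auto
    show "meta_obj d lam (f i) (fh i) differentiable (at \<theta>)" by (rule gradient_meta_obj[OF \<theta>])
    define s where "s = \<delta> powr (1/3)"
    have s: "s > 0" "s * s * s = \<delta>" "s\<^sup>2 = \<delta> powr (2/3)"
      using \<delta> by (simp_all add: s_def power2_eq_square flip: powr_add)
    have \<nu>s: "c1 * s \<le> \<nu>" "\<nu> \<le> c2 * s" "0 < \<nu>"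
      using \<nu> less_le_trans[OF mult_pos_pos[OF assms(1) s(1)]] by (auto simp: s_def)
    have "\<delta> / \<nu> \<le> \<delta> / (c1 * s)"
      using \<delta> s assms \<nu>s by (intro divide_left_mono) auto
    also have "\<dots> = s\<^sup>2 / c1" using s(1) assms by (simp add: power2_eq_square flip: s(2))
    finally have "\<delta> / \<nu> \<le> s\<^sup>2 / c1" .
    moreover have "G * \<nu>\<^sup>2 \<le> G * (c2 * s)\<^sup>2"
    proof (intro mult_left_mono power_mono)
      have "0 \<le> L2" "0 \<le> Lh3"
        using train_C4 test_C3 by (auto simp: train_C4_def test_C3_def dest: lipschitz_on_nonneg)
      then show "0 \<le> G" using constants_nonneg mu by (auto simp: G_def E_def a_def)
    qed (use \<nu>s in auto)
    ultimately have le: "G * \<nu>\<^sup>2 + \<delta> / \<nu> \<le> (G * c2\<^sup>2 + 1 / c1) * s\<^sup>2"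
      by (simp add: algebra_simps power_mult_distrib)
    have "norm (lam *\<^sub>R sens \<theta> - g_Sym lam (\<psi> i) \<nu> \<theta>) \<le> lam * (G * \<nu>\<^sup>2 + \<delta> / \<nu>)"
      using symmetric_error[OF \<theta> \<nu>s(3)] approx i \<theta> by (simp add: G_def E_def a_def)
    also have "\<dots> \<le> lam * ((G * c2\<^sup>2 + 1 / c1) * s\<^sup>2)"
      using le lam by (intro mult_left_mono) auto
    finally show "norm (gradient (meta_obj d lam (f i) (fh i)) \<theta> - g_Sym lam (\<psi> i) \<nu> \<theta>)
        \<le> (G * c2\<^sup>2 + 1 / c1) * (lam * \<delta> powr (2/3))"
      by (simp add: gradient_meta_obj[OF \<theta>] mult_ac flip: s(3))
  qed simp
qed

end
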